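(* Let $Z^\star\in\mathcal{S}^d$ be positive semidefinite of rank $r^\star$ with $1\le r^\star\le r$. Suppose the linear map $\mathcal{A}:\mathcal{S}^d\to\mathbb{R}^m$ satisfies, for some $\delta\in(0,1)$, $(1-\delta)\|Z\|_F^2\le\|\mathcal{A}(Z)\|_2^2\le(1+\delta)\|Z\|_F^2$ for all $Z\in\mathcal{S}^d$ of rank at most $6r$, and let $b=\mathcal{A}(Z^\star)$. Apply the LMM method with $F(X)=XX^\top$, $X\in\mathbb{R}^{d\times r}$, and $h(Z)=\|\mathcal{A}(Z)-b\|_2^2$, initialized at $X_0$ and with the Polyak configuration with parameters $\gamma,C_{\mathtt{lb}},C_{\mathtt{ub}}$ satisfying $$\gamma\le\min\left\{1,\frac{C_{\mathtt{lb}}}{2}\right\},\qquad C_{\mathtt{ub}}\le\frac{1}{64\sqrt{2(r-r^\star+1)}}\frac{(1-\delta)^4}{(1+\delta)^4},$$ and suppose $$\|X_0X_0^\top-Z^\star\|_F\le\frac{1}{16\sqrt2}\frac{(1-\delta)^2}{(1+\delta)^2}\lambda_{r^\star}(Z^\star).$$ Then the iterates satisfy $$\|X_kX_k^\top-Z^\star\|_F^2\le\left(1-\frac{\gamma}{32}\frac{(1-\delta)^2}{(1+\delta)^2}\right)^k\|X_0X_0^\top-Z^\star\|_F^2\quad\text{for all }k\ge0.$$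
   Context: $\mathcal{S}^d$ is the space of symmetric $d\times d$ real matrices; matrix spaces carry the trace inner product and Frobenius norm. $\lambda_i(\cdot)$ is the $i$-th largest eigenvalue. LMM (Levenberg-Morrison-Marquardt) method for $f=h\circ F$, $F:\mathbf{E}\to\mathbf{Y}$. Given $x_0$, stepsizes $\gamma_k>0$ and damping coefficients $\lambda_k>0$: for $k\ge0$ let $v_k=\nabla h(F(x_k))$ and set $x_{k+1}=x_k-\gamma_k(\nabla F(x_k)^\top\nabla F(x_k)+\lambda_kI)^{-1}\nabla F(x_k)^\top v_k$, where $\nabla F(x)$ is the derivative (a linear map) and $\nabla F(x)^\top$ its adjoint. Here $x_k$ is $X_k$. Write $z_k=F(x_k)$; let $h^\star$, $\mathcal{Z}^\star$ be the minimum value and set of minimizers of $h$ over $\operatorname{Im}F$, and $\Pi^x$ the orthogonal projection onto the range of $\nabla F(x)$. Polyak configuration with parameters $\gamma>0$, $0<C_{\mathtt{lb}}\le C_{\mathtt{ub}}$: $\gamma_k=\gamma\frac{h(z_k)-h^\star}{\|\Pi^{x_k}v_k\|^2}$ and $C_{\mathtt{lb}}\operatorname{dist}(z_k,\mathcal{Z}^\star)\le\lambda_k\le C_{\mathtt{ub}}\operatorname{dist}(z_k,\mathcal{Z}^\star)$ for all $k$. *)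

theory Defs
  imports "HOL-Analysis.Analysis" "HOL-Computational_Algebra.Polynomial"
begin

section \<open>The Euclidean space of symmetric matrices\<close>

typedef 'n sym_mat = "{A :: real^'n^'n. transpose A = A}"
  morphisms mat_of Sym_mat
  by (rule exI[of _ "mat 1"]) simp

setup_lifting type_definition_sym_mat

lemma transpose_mat_of [simp]: "transpose (mat_of A) = mat_of A"
  using mat_of by auto

lemma subspace_symmetric: "subspace {A :: real^'n^'n. transpose A = A}"
  by (auto simp: subspace_def transpose_def vec_eq_iff)

instantiation sym_mat :: (finite) real_vector
begin

lift_definition zero_sym_mat :: "'a sym_mat" is 0
  by (simp add: transpose_def vec_eq_iff)

lift_definition plus_sym_mat :: "'a sym_mat \<Rightarrow> 'a sym_mat \<Rightarrow> 'a sym_mat" is "(+)"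
  by (simp add: transpose_def vec_eq_iff)

lift_definition minus_sym_mat :: "'a sym_mat \<Rightarrow> 'a sym_mat \<Rightarrow> 'a sym_mat" is "(-)"
  by (simp add: transpose_def vec_eq_iff)

lift_definition uminus_sym_mat :: "'a sym_mat \<Rightarrow> 'a sym_mat" is uminus
  by (simp add: transpose_def vec_eq_iff)

lift_definition scaleR_sym_mat :: "real \<Rightarrow> 'a sym_mat \<Rightarrow> 'a sym_mat" is scaleR
  by (simp add: transpose_def vec_eq_iff)

instance
  by standard (transfer; simp add: algebra_simps)+

end

text \<open>
  The trace inner product \<open>trace (A ** B)\<close> of symmetric matrices is the entrywise inner product of
  \<^typ>\<open>real^'n^'n\<close>, and the associated norm there is the Frobenius norm; both are inherited.
\<close>

instantiation sym_mat :: (finite) real_inner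
begin

lift_definition inner_sym_mat :: "'a sym_mat \<Rightarrow> 'a sym_mat \<Rightarrow> real" is inner .

lift_definition norm_sym_mat :: "'a sym_mat \<Rightarrow> real" is norm .

definition dist_sym_mat :: "'a sym_mat \<Rightarrow> 'a sym_mat \<Rightarrow> real"
  where "dist_sym_mat A B = norm (A - B)"

definition sgn_sym_mat :: "'a sym_mat \<Rightarrow> 'a sym_mat"
  where "sgn_sym_mat A = A /\<^sub>R norm A"

definition uniformity_sym_mat :: "('a sym_mat \<times> 'a sym_mat) filter"
  where "uniformity_sym_mat = (INF e\<in>{0<..}. principal {(A, B). dist A B < e})"

definition open_sym_mat :: "'a sym_mat set \<Rightarrow> bool"
  where "open_sym_mat U \<longleftrightarrow> (\<forall>A\<in>U. eventually (\<lambda>(A', B). A' = A \<longrightarrow> B \<in> U) uniformity)"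

instance
proof
  fix A B C :: "'a sym_mat" and t :: real
  show "inner A B = inner B A" by transfer (rule inner_commute)
  show "inner (A + B) C = inner A C + inner B C" by transfer (rule inner_add_left)
  show "inner (t *\<^sub>R A) B = t * inner A B" by transfer simp
  show "0 \<le> inner A A" by transfer simp
  show "inner A A = 0 \<longleftrightarrow> A = 0" by transfer simp
  show "norm A = sqrt (inner A A)" by transfer (rule norm_eq_sqrt_inner)
qed (simp_all only: dist_sym_mat_def sgn_sym_mat_def uniformity_sym_mat_def open_sym_mat_def)

end

lemma trace_inner_sym_mat: "inner A B = trace (mat_of A ** mat_of B)"
proof -
  have "mat_of B $ i $ j = mat_of B $ j $ i" for i j
    using arg_cong[OF transpose_mat_of[of B], of "\<lambda>M. M $ i $ j"]
    by (simp add: transpose_def del: transpose_mat_of)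
  then show ?thesis
    by (simp add: inner_sym_mat.rep_eq inner_vec_def trace_def matrix_matrix_mult_def)
qed

lemma symmetric_orthonormal_basis:
  "\<exists>B :: 'n::finite sym_mat set. finite B \<and> B \<noteq> {} \<and>
     (\<forall>u\<in>B. \<forall>v\<in>B. inner u v = (if u = v then 1 else 0)) \<and>
     (\<forall>x. (\<forall>u\<in>B. inner x u = 0) \<longleftrightarrow> x = 0)"
proof -
  let ?S = "{A :: real^'n^'n. transpose A = A}"
  obtain B where B: "B \<subseteq> ?S" "pairwise orthogonal B" "\<And>x. x \<in> B \<Longrightarrow> norm x = 1"
    "independent B" "card B = dim ?S" "span B = ?S"
    by (rule orthonormal_basis_subspace[OF subspace_symmetric]) (rule that)
  define C where "C = {u :: 'n sym_mat. mat_of u \<in> B}"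
  have im: "mat_of ` C = B"
  proof
    show "mat_of ` C \<subseteq> B"
      by (auto simp: C_def)
    show "B \<subseteq> mat_of ` C"
    proof
      fix b assume "b \<in> B"
      then have "mat_of (Sym_mat b) = b"
        using B(1) by (intro Sym_mat_inverse) auto
      then show "b \<in> mat_of ` C"
        using \<open>b \<in> B\<close> by (metis (mono_tags, lifting) C_def image_eqI mem_Collect_eq)
    qed
  qed
  have fin: "finite C"
  proof (rule finite_imageD[of mat_of])
    show "finite (mat_of ` C)"
      using im B(4) by (simp add: independent_imp_finite)
  qed (simp add: inj_on_def mat_of_inject)
  have "mat 1 \<in> span B"
    by (simp add: B(6))
  moreover have "mat 1 \<noteq> (0 :: real^'n^'n)"
    by (simp add: mat_def vec_eq_iff)
  ultimately have "B \<noteq> {}"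
    by auto
  then have ne: "C \<noteq> {}"
    using im by auto
  have orth: "inner u v = (if u = v then 1 else 0)" if "u \<in> C" "v \<in> C" for u v
  proof (cases "u = v")
    case True
    then show ?thesis
      using that B(3) by (simp add: C_def inner_sym_mat.rep_eq flip: power2_norm_eq_inner)
  next
    case False
    then have "orthogonal (mat_of u) (mat_of v)"
      using that B(2) by (simp add: C_def pairwise_def mat_of_inject)
    then show ?thesis
      using False by (simp add: inner_sym_mat.rep_eq orthogonal_def)
  qed
  have zero: "x = 0" if "\<forall>u\<in>C. inner x u = 0" for x
  proof -
    have "\<And>b. b \<in> B \<Longrightarrow> orthogonal (mat_of x) b"
      using that im by (auto simp: inner_sym_mat.rep_eq orthogonal_def)
    moreover have "mat_of x \<in> span B"
      by (simp add: B(6))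
    ultimately have "orthogonal (mat_of x) (mat_of x)"
      using orthogonal_to_span by blast
    then show ?thesis
      by (simp add: orthogonal_def mat_of_inject flip: zero_sym_mat.rep_eq)
  qed
  show ?thesis
    using fin ne orth zero by (intro exI[of _ C]) auto
qed

instantiation sym_mat :: (finite) euclidean_space
begin

definition Basis_sym_mat :: "'a sym_mat set" where
  "Basis_sym_mat = (SOME B. finite B \<and> B \<noteq> {} \<and>
     (\<forall>u\<in>B. \<forall>v\<in>B. inner u v = (if u = v then 1 else 0)) \<and>
     (\<forall>x. (\<forall>u\<in>B. inner x u = 0) \<longleftrightarrow> x = 0))"

instance
proof -
  have Basis: "finite (Basis :: 'a sym_mat set) \<and> (Basis :: 'a sym_mat set) \<noteq> {} \<and>
     (\<forall>u\<in>Basis. \<forall>v\<in>Basis. inner u (v :: 'a sym_mat) = (if u = v then 1 else 0)) \<and>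
     (\<forall>x :: 'a sym_mat. (\<forall>u\<in>Basis. inner x u = 0) \<longleftrightarrow> x = 0)"
    unfolding Basis_sym_mat_def by (rule someI_ex[OF symmetric_orthonormal_basis])
  show "OFCLASS('a sym_mat, euclidean_space_class)"
  proof
    show "Basis \<noteq> ({} :: 'a sym_mat set)" "finite (Basis :: 'a sym_mat set)"
      using Basis by simp_all
    show "inner u v = (if u = v then 1 else 0)" if "u \<in> Basis" "v \<in> Basis" for u v :: "'a sym_mat"
      using Basis that by blast
    show "(\<forall>u\<in>Basis. inner x u = 0) \<longleftrightarrow> x = 0" for x :: "'a sym_mat"
      using Basis by blast
  qed
qed

end

definition psd :: "'n::finite sym_mat \<Rightarrow> bool"
  where "psd Z \<longleftrightarrow> (\<forall>x. 0 \<le> x \<bullet> (mat_of Z *v x))"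

definition charpoly :: "real^'n^'n \<Rightarrow> real poly"
  where "charpoly A = det (\<chi> i j. (if i = j then [:0, 1:] else 0) - [:A $ i $ j:])"

text \<open>
  The \<open>i\<close>-th largest eigenvalue, counted with multiplicity; indices run from \<open>1\<close> to \<open>CARD('n)\<close>.
\<close>

definition eigval :: "nat \<Rightarrow> 'n::finite sym_mat \<Rightarrow> real"
  where "eigval i Z = rev (sorted_list_of_multiset (proots (charpoly (mat_of Z)))) ! (i - 1)"


section \<open>The Levenberg--Morrison--Marquardt method\<close>

definition gradient :: "('a::real_inner \<Rightarrow> real) \<Rightarrow> 'a \<Rightarrow> 'a"
  where "gradient h z = (THE v. GDERIV h z :> v)"

definition orth_proj :: "'a::real_inner set \<Rightarrow> 'a \<Rightarrow> 'a"
  where "orth_proj S v = (THE p. p \<in> S \<and> (\<forall>s\<in>S. orthogonal (v - p) s))"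

definition minimizers :: "('a \<Rightarrow> real) \<Rightarrow> 'a set \<Rightarrow> 'a set"
  where "minimizers h S = {z. is_arg_min h (\<lambda>w. w \<in> S) z}"

definition lmm_step ::
    "('e::euclidean_space \<Rightarrow> 'y::euclidean_space) \<Rightarrow> ('y \<Rightarrow> real) \<Rightarrow> real \<Rightarrow> real \<Rightarrow> 'e \<Rightarrow> 'e"
  where "lmm_step F h g l x =
    (let J = frechet_derivative F (at x); v = gradient h (F x)
     in x - g *\<^sub>R inv (\<lambda>u. adjoint J (J u) + l *\<^sub>R u) (adjoint J v))"

text \<open>
  At a minimizer the Polyak stepsize reads \<open>0/0\<close> and the bounds below force the damping to vanish,
  so no admissible step exists there. The method is then taken to stop, that is, to stay at the
  current iterate; up to that point all stepsizes and damping coefficients must be positive.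
\<close>

definition lmm_iterates ::
    "('e::euclidean_space \<Rightarrow> 'y::euclidean_space) \<Rightarrow> ('y \<Rightarrow> real)
      \<Rightarrow> (nat \<Rightarrow> real) \<Rightarrow> (nat \<Rightarrow> real) \<Rightarrow> (nat \<Rightarrow> 'e) \<Rightarrow> bool"
  where "lmm_iterates F h steps damps x \<longleftrightarrow>
    (\<forall>k. if F (x k) \<in> minimizers h (range F) then x (Suc k) = x k
         else 0 < steps k \<and> 0 < damps k \<and> x (Suc k) = lmm_step F h (steps k) (damps k) (x k))"

definition polyak_configuration ::
    "('e::euclidean_space \<Rightarrow> 'y::euclidean_space) \<Rightarrow> ('y \<Rightarrow> real) \<Rightarrow> real \<Rightarrow> real \<Rightarrow> real
      \<Rightarrow> (nat \<Rightarrow> real) \<Rightarrow> (nat \<Rightarrow> real) \<Rightarrow> (nat \<Rightarrow> 'e) \<Rightarrow> bool"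
  where "polyak_configuration F h \<gamma> C_lb C_ub steps damps x \<longleftrightarrow>
    (\<forall>k. F (x k) \<notin> minimizers h (range F) \<longrightarrow>
      (let z = F (x k);
           h_min = (INF w\<in>range F. h w);
           proj = orth_proj (range (frechet_derivative F (at (x k))));
           D = infdist z (minimizers h (range F))
       in steps k = \<gamma> * (h z - h_min) / (norm (proj (gradient h z)))\<^sup>2
          \<and> C_lb * D \<le> damps k \<and> damps k \<le> C_ub * D))"


section \<open>Matrix sensing\<close>

lift_definition gram :: "real^'r^'d \<Rightarrow> 'd::finite sym_mat" is "\<lambda>X. X ** transpose X"
  by (simp add: matrix_transpose_mul)

definition sensing_loss :: "('d::finite sym_mat \<Rightarrow> real^'m) \<Rightarrow> real^'m \<Rightarrow> 'd sym_mat \<Rightarrow> real"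
  where "sensing_loss \<A> b Z = (norm (\<A> Z - b))\<^sup>2"

end

theory Submission
  imports Defs
begin

text \<open>
  Write \<open>E = X X\<^sup>T - Z\<^sup>*\<close> for the residual of an iterate \<open>X\<close>, \<open>J\<close> for the derivative of the Gram
  map at \<open>X\<close>, \<open>v\<close> for the gradient of the loss, \<open>q\<close> for the projection of \<open>v\<close> onto the range of \<open>J\<close>,
  \<open>u\<close> for the damped direction, which solves \<open>(J\<^sup>T J + l) u = J\<^sup>T v\<close>, and \<open>w = J u\<close>. As the Gram map
  is quadratic, the step changes the residual into \<open>E - g w + g\<^sup>2 u u\<^sup>T\<close> exactly. The normal equations
  give \<open>norm w \<le> norm q\<close> and \<open>4 l (norm u)\<^sup>2 \<le> (norm q)\<^sup>2\<close>, so the damping, which is at least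
  \<open>C_lb * norm E\<close>, keeps the quadratic term small. Once the alignment \<open>E \<bullet> w \<ge> h\<close> with the loss
  value \<open>h\<close> is known, the Polyak stepsize makes the squared residual drop by at least \<open>g h / 2\<close>
  (\<open>polyak_step_descent\<close>). Restricted isometry bounds \<open>norm q\<close> by \<open>2 sqrt ((1 + \<delta>) h)\<close> and \<open>h\<close> from
  below by \<open>(1 - \<delta>) (norm E)\<^sup>2\<close>, which turns this drop into the claimed linear rate
  (\<open>lmm_step_contraction\<close>).

  The alignment is the heart of the matter, since \<open>J\<close> may have arbitrarily small singular values when
  \<open>X\<close> has more columns than the rank of \<open>Z\<^sup>*\<close>. It rests on a decomposition \<open>E = J J\<^sup>T V + R\<close>
  (\<open>gram_residual_decomposition\<close>). Damping costs only \<open>l (V \<bullet> w)\<close> on the first part: the normal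
  equations give \<open>J J\<^sup>T V \<bullet> w = J J\<^sup>T V \<bullet> v - l (V \<bullet> w)\<close>, without any reference to the
  singular values. So it suffices that \<open>V\<close> has bounded norm and \<open>R\<close> is quadratically small.

  To find \<open>V\<close> and \<open>R\<close>, diagonalize \<open>X X\<^sup>T\<close>. There \<open>J J\<^sup>T\<close> multiplies the entry \<open>(i, j)\<close> by
  \<open>2 (\<mu> i + \<mu> j)\<close>. Call an index small if \<open>\<mu> i\<close> is at most half of the least nonzero eigenvalue
  \<open>\<lambda>\<close> of \<open>Z\<^sup>*\<close>. On entries with a large index, \<open>J J\<^sup>T\<close> is inverted at the cost of a factor
  \<open>1 / \<lambda>\<close>. On the small block, the part of \<open>E\<close> coming from \<open>X X\<^sup>T\<close> is diagonal with entries \<open>\<mu> i\<close>, which is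
  the image of \<open>1/4\<close> times the identity on its support; the support has at most \<open>r - r\<^sup>*\<close> indices, and
  this is where \<open>sqrt (r - r\<^sup>* + 1)\<close> enters. What remains is the small block of \<open>- Z\<^sup>*\<close>, which a
  Davis--Kahan type estimate bounds by \<open>4 (norm E)\<^sup>2 / \<lambda>\<close>.
\<close>


section \<open>Diagonalization of symmetric matrices\<close>

text \<open>
  A maximizer \<open>x\<close> of the Rayleigh quotient on the unit sphere of the subspace is an eigenvector: with
  \<open>\<mu>\<close> the maximum, the form \<open>\<mu> (y \<bullet> y) - y \<bullet> f y\<close> is nonnegative on the subspace and vanishes at
  \<open>x\<close>, so its first variation at \<open>x\<close> vanishes.
\<close>

lemma selfadjoint_has_eigenvector:
  fixes f :: "'a::euclidean_space \<Rightarrow> 'a"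
  assumes lin: "linear f" and sa: "\<And>x y. f x \<bullet> y = x \<bullet> f y"
    and S: "subspace S" "S \<noteq> {0}" and inv: "\<And>x. x \<in> S \<Longrightarrow> f x \<in> S"
  obtains x \<mu> where "x \<in> S" "norm x = 1" "f x = \<mu> *\<^sub>R x"
proof -
  let ?K = "S \<inter> sphere 0 1"
  have "compact ?K"
    using S by (intro closed_Int_compact closed_subspace) auto
  moreover have "?K \<noteq> {}"
  proof -
    obtain y where "y \<in> S" "y \<noteq> 0" using S subspace_0 by blast
    then have "y /\<^sub>R norm y \<in> ?K" using S by (simp add: subspace_scale)
    then show ?thesis by blast
  qed
  moreover have "continuous_on ?K (\<lambda>x. x \<bullet> f x)"
    using lin by (intro continuous_intros linear_continuous_on) (simp add: linear_linear)
  ultimately obtain x where x: "x \<in> ?K" and max: "\<And>y. y \<in> ?K \<Longrightarrow> y \<bullet> f y \<le> x \<bullet> f x"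
    using continuous_attains_sup by meson
  define \<mu> where "\<mu> = x \<bullet> f x"
  have xx: "x \<in> S" "norm x = 1" using x by auto
  have le: "y \<bullet> f y \<le> \<mu> * (y \<bullet> y)" if "y \<in> S" for y
  proof (cases "y = 0")
    case False
    have "y /\<^sub>R norm y \<in> ?K" using that S False by (simp add: subspace_scale)
    from max[OF this] have "(y \<bullet> f y) / (norm y)\<^sup>2 \<le> \<mu>"
      using lin by (simp add: linear_scale \<mu>_def power2_eq_square divide_inverse mult_ac)
    then show ?thesis using False by (simp add: divide_le_eq power2_norm_eq_inner)
  qed (use lin linear_0 in auto)
  define r where "r = \<mu> *\<^sub>R x - f x"
  have rS: "r \<in> S" unfolding r_def using xx S inv by (simp add: subspace_diff subspace_scale)
  have quad: "0 \<le> 2 * t * (r \<bullet> r) + t\<^sup>2 * (\<mu> * (r \<bullet> r) - r \<bullet> f r)" for t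
  proof -
    have "x + t *\<^sub>R r \<in> S" using rS xx S by (simp add: subspace_add subspace_scale)
    from le[OF this] have "0 \<le> \<mu> * ((x + t *\<^sub>R r) \<bullet> (x + t *\<^sub>R r)) - (x + t *\<^sub>R r) \<bullet> f (x + t *\<^sub>R r)"
      by simp
    also have "\<dots> = (\<mu> * (x \<bullet> x) - x \<bullet> f x) + 2 * t * (r \<bullet> (\<mu> *\<^sub>R x - f x))
        + t\<^sup>2 * (\<mu> * (r \<bullet> r) - r \<bullet> f r)"
      using sa[of x r] lin
      by (simp add: linear_add linear_scale inner_add_left inner_add_right inner_diff_right
          inner_commute power2_eq_square algebra_simps)
    also have "\<mu> * (x \<bullet> x) - x \<bullet> f x = 0"
      using xx by (simp add: \<mu>_def flip: power2_norm_eq_inner)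
    finally show ?thesis by (simp add: r_def)
  qed
  have "r = 0"
  proof (rule ccontr)
    assume "r \<noteq> 0"
    then have a: "r \<bullet> r > 0" by simp
    define b where "b = \<mu> * (r \<bullet> r) - r \<bullet> f r"
    have b: "b \<ge> 0" using le[OF rS] by (simp add: b_def)
    \<comment> \<open>A negative \<open>t\<close> small enough that the linear term of \<open>quad\<close> dominates the quadratic one;
       adding 1 to \<open>b\<close> covers the case that \<open>b\<close> is zero.\<close>
    define t where "t = - (r \<bullet> r) / (b + 1)"
    have "2 * t * (r \<bullet> r) + t\<^sup>2 * b = t * (2 * (r \<bullet> r) + t * b)"
      by (simp add: power2_eq_square algebra_simps)
    moreover have "t < 0" using a b by (simp add: t_def)
    moreover have "2 * (r \<bullet> r) + t * b > 0"
    proof -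
      have "(r \<bullet> r) * b / (b + 1) \<le> r \<bullet> r" using a b by (simp add: divide_le_eq)
      moreover have "r \<bullet> r < 2 * (r \<bullet> r)" using a by simp
      moreover have "t * b = - ((r \<bullet> r) * b / (b + 1))" by (simp add: t_def)
      ultimately show ?thesis by linarith
    qed
    ultimately have "2 * t * (r \<bullet> r) + t\<^sup>2 * b < 0" by (simp add: mult_neg_pos)
    with quad[of t] show False by (simp add: b_def)
  qed
  then have "f x = \<mu> *\<^sub>R x" by (simp add: r_def)
  then show thesis using that xx by blast
qed

text \<open>
  Take an orthonormal set of eigenvectors of greatest cardinality. Its orthogonal complement is
  invariant, so a nonzero complement would contain a further eigenvector.
\<close>

lemma selfadjoint_orthonormal_eigenbasis:
  fixes f :: "'a::euclidean_space \<Rightarrow> 'a"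
  assumes lin: "linear f" and sa: "\<And>x y. f x \<bullet> y = x \<bullet> f y"
  obtains B where "pairwise orthogonal B" "\<And>b. b \<in> B \<Longrightarrow> norm b = 1" "finite B"
    "card B = DIM('a)" "\<And>b. b \<in> B \<Longrightarrow> \<exists>\<mu>. f b = \<mu> *\<^sub>R b"
proof -
  define P where "P B \<longleftrightarrow> pairwise orthogonal B \<and> (\<forall>b\<in>B. norm b = 1 \<and> (\<exists>\<mu>. f b = \<mu> *\<^sub>R b))"
    for B :: "'a set"
  have ind: "independent B" if "P B" for B
    using that unfolding P_def by (intro pairwise_orthogonal_independent) auto
  have bd: "card B \<le> DIM('a)" "finite B" if "P B" for B
    by (rule independent_card_le[OF ind[OF that]], rule independent_imp_finite[OF ind[OF that]])
  have "P {}" by (simp add: P_def)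
  then obtain B where B: "P B" and max: "\<And>C. P C \<Longrightarrow> card C \<le> card B"
    using ex_has_greatest_nat[of P "{}" card "Suc DIM('a)"] bd(1) le_imp_less_Suc by blast
  define T where "T = {y. \<forall>b\<in>B. y \<bullet> b = 0}"
  have T: "subspace T" by (auto simp: T_def subspace_def inner_add_left)
  have Tinv: "f y \<in> T" if "y \<in> T" for y
  proof -
    have "f y \<bullet> b = 0" if b: "b \<in> B" for b
    proof -
      obtain \<mu> where "f b = \<mu> *\<^sub>R b" using B b by (auto simp: P_def)
      then show ?thesis using \<open>y \<in> T\<close> b by (simp add: sa T_def)
    qed
    then show ?thesis by (simp add: T_def)
  qed
  have "T = {0}"
  proof (rule ccontr)
    assume "T \<noteq> {0}"
    then obtain x \<mu> where x: "x \<in> T" "norm x = 1" "f x = \<mu> *\<^sub>R x"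
      using selfadjoint_has_eigenvector[OF lin sa T _ Tinv] by blast
    then have "x \<notin> B" by (auto simp: T_def norm_eq_1)
    moreover have "P (insert x B)"
      using B x by (auto simp: P_def pairwise_insert orthogonal_def T_def inner_commute)
    ultimately show False using max[of "insert x B"] bd[OF B] by simp
  qed
  then have "span B = UNIV"
  proof -
    have "x \<in> span B" for x
    proof -
      obtain y z where "y \<in> span B" "\<And>w. w \<in> span B \<Longrightarrow> orthogonal z w" "x = y + z"
        using orthogonal_subspace_decomp_exists by blast
      moreover then have "z \<in> T" by (auto simp: T_def orthogonal_def span_base)
      ultimately show ?thesis using \<open>T = {0}\<close> by simp
    qed
    then show ?thesis by auto
  qed
  then have "card B = DIM('a)"
    using ind[OF B] by (metis basis_card_eq_dim dim_UNIV order_refl span_UNIV span_superset)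
  then show thesis using that[of B] B bd[OF B] by (auto simp: P_def)
qed

lemma matrix_add_rdistrib: "(A + B) ** C = A ** C + B ** C" for A :: "'a::semiring_1^'n^'m"
  by (simp add: matrix_matrix_mult_def vec_eq_iff distrib_right sum.distrib)

lemma matrix_diff_ldistrib: "A ** (B - C) = A ** B - A ** C" for A :: "'a::ring_1^'n^'m"
  by (simp add: matrix_matrix_mult_def vec_eq_iff right_diff_distrib sum_subtractf)

lemma matrix_diff_rdistrib: "(A - B) ** C = A ** C - B ** C" for A :: "'a::ring_1^'n^'m"
  by (simp add: matrix_matrix_mult_def vec_eq_iff left_diff_distrib sum_subtractf)

definition diag :: "('n::finite \<Rightarrow> 'a::zero) \<Rightarrow> 'a^'n^'n"
  where "diag \<mu> = (\<chi> i j. if i = j then \<mu> i else 0)"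

lemma diag_nth: "diag \<mu> $ i $ j = (if i = j then \<mu> i else 0)"
  by (simp add: diag_def)

lemma matrix_diag_nth: "(A ** diag \<mu>) $ i $ j = A $ i $ j * \<mu> j" for A :: "'a::semiring_1^'n^'m"
  by (simp add: matrix_matrix_mult_def diag_nth if_distrib[of "\<lambda>x. _ * x"] cong: if_cong)

lemma diag_matrix_nth: "(diag \<mu> ** A) $ i $ j = \<mu> i * A $ i $ j" for A :: "'a::semiring_1^'n^'m"
  by (simp add: matrix_matrix_mult_def diag_nth if_distrib[of "\<lambda>x. x * _"] cong: if_cong)

theorem symmetric_matrix_diagonalization:
  fixes A :: "real^'n^'n"
  assumes "transpose A = A"
  obtains Q \<mu> where "orthogonal_matrix Q" "A = Q ** diag \<mu> ** transpose Q"
proof -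
  have "(A *v x) \<bullet> y = x \<bullet> (A *v y)" for x y
    using assms by (metis dot_lmul_matrix vector_transpose_matrix)
  then obtain B where B: "pairwise orthogonal B" "\<And>b. b \<in> B \<Longrightarrow> norm b = 1" "finite B"
    "card B = DIM(real^'n)" "\<And>b. b \<in> B \<Longrightarrow> \<exists>\<mu>. A *v b = \<mu> *\<^sub>R b"
    using selfadjoint_orthonormal_eigenbasis[of "(*v) A"] matrix_vector_mul_linear by blast
  obtain b where b: "bij_betw b (UNIV :: 'n set) B"
    using finite_same_card_bij[of "UNIV :: 'n set" B] B(3,4) by auto
  then have bB: "b i \<in> B" for i by (auto simp: bij_betw_def)
  obtain \<mu> where \<mu>: "\<And>i. A *v b i = \<mu> i *\<^sub>R b i" using B(5)[OF bB] by metis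
  define Q where "Q = (\<chi> i j. b j $ i)"
  have col: "column j Q = b j" for j by (simp add: Q_def column_def vec_eq_iff)
  have "orthogonal (b i) (b j)" if "i \<noteq> j" for i j
    using that B(1) bB b by (metis UNIV_I bij_betw_def inj_on_def pairwise_def)
  then have Q: "orthogonal_matrix Q"
    by (simp add: orthogonal_matrix_orthonormal_columns col B(2)[OF bB])
  have "A ** Q = Q ** diag \<mu>"
  proof -
    have "(A ** Q) $ i $ j = (A *v b j) $ i" for i j
      by (simp add: matrix_matrix_mult_def matrix_vector_mult_def Q_def)
    then show ?thesis by (simp add: vec_eq_iff matrix_diag_nth \<mu> Q_def)
  qed
  then have "A = Q ** diag \<mu> ** transpose Q"
    using Q by (metis matrix_mul_assoc matrix_mul_rid orthogonal_matrix_def)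
  then show thesis using that Q by blast
qed

section \<open>Rank and Frobenius norm\<close>

lemma rank_orthogonal_conj:
  fixes D :: "real^'n^'n"
  assumes "orthogonal_matrix Q"
  shows "rank (Q ** D ** transpose Q) = rank D"
proof (rule antisym)
  show "rank (Q ** D ** transpose Q) \<le> rank D"
    by (meson order_trans rank_mul_le_left rank_mul_le_right)
  have "D = transpose Q ** (Q ** D ** transpose Q) ** Q"
    using assms by (metis matrix_mul_assoc matrix_mul_lid matrix_mul_rid orthogonal_matrix_def)
  then show "rank D \<le> rank (Q ** D ** transpose Q)"
    by (metis order_trans rank_mul_le_left rank_mul_le_right)
qed

text \<open>
  The nonzero rows are multiples of distinct unit vectors.
\<close>

lemma rank_diag: "rank (diag \<mu> :: real^'n^'n) = card {i. \<mu> i \<noteq> 0}"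
proof -
  let ?B = "(\<lambda>i. axis i 1 :: real^'n) ` {i. \<mu> i \<noteq> 0}"
  have row: "row i (diag \<mu>) = \<mu> i *\<^sub>R axis i 1" for i
    by (simp add: row_def diag_def axis_def vec_eq_iff)
  have "rows (diag \<mu>) \<subseteq> span ?B \<and> ?B \<subseteq> span (rows (diag \<mu>))"
  proof
    show "rows (diag \<mu>) \<subseteq> span ?B"
    proof
      fix x assume "x \<in> rows (diag \<mu>)"
      then obtain i where "x = \<mu> i *\<^sub>R axis i 1" by (auto simp: rows_def row)
      then show "x \<in> span ?B"
        by (cases "\<mu> i = 0") (auto intro: span_zero span_scale span_base)
    qed
    show "?B \<subseteq> span (rows (diag \<mu>))"
    proof clarify
      fix i assume "\<mu> i \<noteq> 0"
      then have "axis i 1 = inverse (\<mu> i) *\<^sub>R row i (diag \<mu>)" by (simp add: row)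
      moreover have "row i (diag \<mu>) \<in> span (rows (diag \<mu>))"
        by (intro span_base) (auto simp: rows_def)
      ultimately show "axis i 1 \<in> span (rows (diag \<mu>))"
        by (simp only: span_scale)
    qed
  qed
  then have "span (rows (diag \<mu>)) = span ?B" by (simp add: span_eq)
  moreover have "independent ?B"
    by (rule independent_mono[OF independent_Basis]) (auto simp: axis_in_Basis_iff)
  ultimately have "dim (rows (diag \<mu>)) = card ?B"
    by (metis dim_eq_card)
  also have "\<dots> = card {i. \<mu> i \<noteq> 0}"
    by (intro card_image) (auto simp: inj_on_def axis_eq_axis)
  finally show ?thesis by (simp add: row_rank_def)
qed

lemma rank_add_le: "rank (A + B) \<le> rank A + rank B" for A B :: "real^'n^'m"
proof -
  have "range ((*v) (A + B)) \<subseteq> {x + y | x y. x \<in> range ((*v) A) \<and> y \<in> range ((*v) B)}"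
    by (auto simp: matrix_vector_mult_add_rdistrib)
  then have "dim (range ((*v) (A + B))) \<le> dim {x + y | x y. x \<in> range ((*v) A) \<and> y \<in> range ((*v) B)}"
    by (rule dim_subset)
  also have "\<dots> \<le> dim (range ((*v) A)) + dim (range ((*v) B))"
    using dim_sums_Int[of "range ((*v) A)" "range ((*v) B)"]
    by (simp add: linear_subspace_image matrix_vector_mul_linear)
  finally show ?thesis by (simp add: rank_dim_range)
qed

lemma rank_minus: "rank (- A) = rank A" for A :: "real^'n^'m"
proof -
  have "range ((*v) (- A)) = range ((*v) A)"
  proof -
    have "(- A) *v x = A *v (- x)" for x
      by (simp add: matrix_vector_mult_def vec_eq_iff)
    then have "(*v) (- A) = (*v) A \<circ> uminus" by (simp add: fun_eq_iff)
    then have "range ((*v) (- A)) = (*v) A ` range uminus" by (simp only: image_comp)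
    also have "range uminus = (UNIV :: (real^'n) set)" by (rule surj_uminus)
    finally show ?thesis .
  qed
  then show ?thesis by (simp add: rank_dim_range)
qed

lemma rank_le_cols: "rank A \<le> CARD('n)" for A :: "real^'n^'m"
  using rank_bound[of A] by simp

lemma rank_mult_le_inner_dim: "rank (A ** B) \<le> CARD('r)" for A :: "real^'r^'m" and B :: "real^'n^'r"
  by (meson order_trans rank_le_cols rank_mul_le_left)

lemma norm_matrix_sq: "(norm A)\<^sup>2 = (\<Sum>i\<in>UNIV. \<Sum>j\<in>UNIV. (A $ i $ j)\<^sup>2)" for A :: "real^'n^'m"
  by (simp add: power2_norm_eq_inner inner_vec_def) (simp add: power2_eq_square)

lemma norm_transpose [simp]: "norm (transpose A) = norm A" for A :: "real^'n^'m"
proof -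
  have "(norm (transpose A))\<^sup>2 = (norm A)\<^sup>2"
    unfolding norm_matrix_sq by (subst sum.swap) (simp add: transpose_def)
  then show ?thesis by simp
qed

lemma norm_orthogonal_matrix_mult:
  fixes A :: "real^'m^'n"
  assumes "orthogonal_matrix Q" shows "norm (Q ** A) = norm A"
proof -
  have cols: "(norm B)\<^sup>2 = (\<Sum>j\<in>UNIV. (norm (column j B))\<^sup>2)" for B :: "real^'m^'n"
    unfolding norm_matrix_sq power2_norm_eq_inner
    by (subst sum.swap) (simp add: inner_vec_def column_def flip: power2_eq_square)
  have "norm (Q *v x) = norm x" for x
    using assms orthogonal_transformation_matrix[of "(*v) Q"] orthogonal_transformation_norm
    by (metis matrix_of_matrix_vector_mul matrix_vector_mul_linear)
  moreover have "column j (Q ** A) = Q *v column j A" for j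
    by (simp add: column_def matrix_matrix_mult_def matrix_vector_mult_def)
  ultimately have "(norm (Q ** A))\<^sup>2 = (norm A)\<^sup>2" by (simp add: cols)
  then show ?thesis by simp
qed

lemma norm_mult_orthogonal_matrix:
  fixes A :: "real^'n^'m"
  assumes "orthogonal_matrix Q" shows "norm (A ** Q) = norm A"
proof -
  have "norm (A ** Q) = norm (transpose Q ** transpose A)" by (metis matrix_transpose_mul norm_transpose)
  then show ?thesis using assms by (simp add: norm_orthogonal_matrix_mult)
qed

section \<open>Eigenvalues as roots of the characteristic polynomial\<close>

lemma sum_const_poly: "(\<Sum>k\<in>A. [:f k:]) = [:\<Sum>k\<in>A. f k:]"
  by (induction A rule: infinite_finite_induct) auto

abbreviation const_polys :: "real^'n^'n \<Rightarrow> real poly^'n^'n"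
  where "const_polys A \<equiv> \<chi> i j. [:A $ i $ j:]"

lemma const_polys_mult: "const_polys (A ** B) = const_polys A ** const_polys B"
  by (simp add: matrix_matrix_mult_def vec_eq_iff sum_const_poly mult.commute)

text \<open>
  The factorization also holds for the matrix \<open>x I - A\<close> over the polynomials, with constant orthogonal
  factors whose determinants cancel.
\<close>

lemma charpoly_diagonalization:
  fixes Q :: "real^'n^'n"
  assumes Q: "orthogonal_matrix Q"
  shows "charpoly (Q ** diag \<mu> ** transpose Q) = (\<Prod>i\<in>UNIV. [:- \<mu> i, 1:])"
proof -
  let ?X = "diag (\<lambda>_. [:0, 1:]) :: real poly^'n^'n"
  let ?Q = "const_polys Q" and ?Qt = "const_polys (transpose Q)"
  have QQ: "?Q ** ?Qt = mat 1"
  proof -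
    have "?Q ** ?Qt = const_polys (mat 1)"
      using Q by (simp add: orthogonal_matrix_def flip: const_polys_mult)
    then show ?thesis by (simp add: mat_def vec_eq_iff)
  qed
  have "?Q ** ?X = ?X ** ?Q" by (simp add: vec_eq_iff matrix_diag_nth diag_matrix_nth)
  then have "?X = ?Q ** ?X ** ?Qt" by (simp add: QQ flip: matrix_mul_assoc)
  then have "?X - const_polys (Q ** diag \<mu> ** transpose Q) = ?Q ** (?X - const_polys (diag \<mu>)) ** ?Qt"
    by (simp add: const_polys_mult matrix_diff_ldistrib matrix_diff_rdistrib)
  moreover have "charpoly A = det (?X - const_polys A)" for A :: "real^'n^'n"
    unfolding charpoly_def by (rule arg_cong[where f = det]) (simp add: diag_def vec_eq_iff)
  moreover have "?X - const_polys (diag \<mu>) = diag (\<lambda>i. [:- \<mu> i, 1:])"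
    by (simp add: diag_def vec_eq_iff)
  moreover have "det ?Q * det ?Qt = 1"
    by (metis QQ det_I det_mul)
  ultimately have "charpoly (Q ** diag \<mu> ** transpose Q) = det (diag (\<lambda>i. [:- \<mu> i, 1:]))"
    by (simp add: det_mul mult_ac)
  also have "\<dots> = (\<Prod>i\<in>UNIV. [:- \<mu> i, 1:])"
    by (subst det_diagonal) (auto simp: diag_nth)
  finally show ?thesis .
qed

lemma proots_charpoly_diagonalization:
  fixes Q :: "real^'n^'n"
  assumes "orthogonal_matrix Q"
  shows "proots (charpoly (Q ** diag \<mu> ** transpose Q)) = image_mset \<mu> (mset_set UNIV)"
proof -
  have "proots (\<Prod>i\<in>UNIV. [:- \<mu> i, 1:]) = (\<Sum>i\<in>UNIV. {#\<mu> i#})"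
    by (subst proots_prod) auto
  then show ?thesis
    using assms by (simp add: charpoly_diagonalization sum_unfold_sum_mset)
qed

text \<open>
  This turns a position in the sorted list of eigenvalues into a count, which does not depend on the
  order of the list.
\<close>

lemma descending_nth_count:
  fixes M :: "real multiset"
  assumes "1 \<le> k" "k \<le> size M"
  defines "t \<equiv> rev (sorted_list_of_multiset M) ! (k - 1)"
  shows "k \<le> size (filter_mset (\<lambda>y. t \<le> y) M)"
proof -
  define L where "L = rev (sorted_list_of_multiset M)"
  have M: "mset L = M" by (simp add: L_def)
  have len: "length L = size M" using arg_cong[OF M, of size] by simp
  have "t \<le> L ! i" if "i < k" for i
  proof -
    have "sorted (rev L)" by (simp add: L_def)
    then show ?thesis
      using that assms(1,2) len unfolding t_def L_def[symmetric]
      by (intro sorted_rev_nth_mono) auto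
  qed
  then have "{..<k} \<subseteq> {i. i < length L \<and> t \<le> L ! i}" using assms len by auto
  then have "card {..<k} \<le> length (filter (\<lambda>y. t \<le> y) L)"
    unfolding length_filter_conv_card by (intro card_mono) auto
  also have "\<dots> = size (filter_mset (\<lambda>y. t \<le> y) M)"
    unfolding M[symmetric] by (simp flip: mset_filter)
  finally show ?thesis by simp
qed

text \<open>
  If a positive eigenvalue were smaller than the eigenvalue at the position of the rank, then it and
  all the eigenvalues up to that position would be nonzero, one more than the rank allows. For a
  positive semidefinite matrix, the bound is thus the least nonzero eigenvalue.
\<close>

lemma eigval_rank_le:
  fixes Z :: "'n::finite sym_mat"
  assumes Q: "orthogonal_matrix Q" and Z: "mat_of Z = Q ** diag \<nu> ** transpose Q"
    and pos: "\<nu> n > 0"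
  shows "eigval (rank (mat_of Z)) Z \<le> \<nu> n"
proof (rule ccontr)
  let ?k = "rank (mat_of Z)"
  assume "\<not> eigval ?k Z \<le> \<nu> n"
  then have less: "\<nu> n < eigval ?k Z" by simp
  have k: "?k = card {i. \<nu> i \<noteq> 0}"
    by (simp add: Z rank_orthogonal_conj[OF Q] rank_diag)
  define M where "M = image_mset \<nu> (mset_set UNIV)"
  have e: "eigval ?k Z = rev (sorted_list_of_multiset M) ! (?k - 1)"
    by (simp add: eigval_def proots_charpoly_diagonalization[OF Q] Z M_def)
  have "1 \<le> ?k" 
  proof -
    have "n \<in> {i. \<nu> i \<noteq> 0}" using pos by simp
    then have "0 < card {i. \<nu> i \<noteq> 0}" by (metis card_gt_0_iff empty_iff finite)
    then show ?thesis by (simp add: k)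
  qed
  moreover have "?k \<le> size M" unfolding k M_def by (simp add: card_mono)
  ultimately have "?k \<le> size (filter_mset (\<lambda>y. eigval ?k Z \<le> y) M)"
    unfolding e by (rule descending_nth_count)
  also have "\<dots> = card {i. eigval ?k Z \<le> \<nu> i}"
    by (simp add: M_def filter_mset_image_mset filter_mset_mset_set)
  also have "\<dots> < card {i. \<nu> i \<noteq> 0}"
  proof (rule psubset_card_mono)
    have "n \<in> {i. \<nu> i \<noteq> 0} - {i. eigval ?k Z \<le> \<nu> i}" using less pos by auto
    moreover have "{i. eigval ?k Z \<le> \<nu> i} \<subseteq> {i. \<nu> i \<noteq> 0}" using less pos by auto
    ultimately show "{i. eigval ?k Z \<le> \<nu> i} \<subset> {i. \<nu> i \<noteq> 0}" using less pos by blast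
  qed simp
  finally show False by (simp add: k)
qed

section \<open>The residual in an eigenbasis of the iterate\<close>

text \<open>
  Here \<open>diag \<mu>\<close> is \<open>X X\<^sup>T\<close> in its own eigenbasis, and \<open>W\<close> holds the eigenvectors of \<open>Z\<^sup>*\<close> in that
  basis. The map \<open>V \<mapsto> 2 (V D + D V)\<close> is diagonal on matrix entries. It is inverted wherever its
  multiplier \<open>2 (\<mu> i + \<mu> j)\<close> is at least \<open>l\<close>, that is, outside the block of the small indices \<open>S\<close>;
  inside this block \<open>V\<close> reproduces \<open>diag \<mu>\<close>, and the error \<open>R\<close> is the block of \<open>- W diag \<nu> W\<^sup>T\<close>.
  
  The estimates come from \<open>(E W) i n = (\<mu> i - \<nu> n) * W i n\<close>. For a small index \<open>i\<close> and a nonzero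
  \<open>\<nu> n\<close> the gap \<open>\<nu> n - \<mu> i\<close> is at least \<open>\<nu> n / 2\<close>, so \<open>norm E\<close> controls the weight that the small
  indices put on the eigenvectors with nonzero eigenvalue. This weight bounds \<open>R\<close>, and it also shows
  that there are at least as many large indices as nonzero values \<open>\<nu> n\<close>.
\<close>

lemma eigenbasis_residual_decomposition:
  fixes W :: "real^'n^'n" and \<mu> \<nu> :: "'n \<Rightarrow> real"
  defines "E \<equiv> diag \<mu> - W ** diag \<nu> ** transpose W"
  assumes W: "orthogonal_matrix W"
    and \<mu>: "\<And>i. 0 \<le> \<mu> i" and l: "0 < l" and \<nu>: "\<And>n. \<nu> n = 0 \<or> l \<le> \<nu> n"
    and small: "norm E \<le> l / 4"
  obtains V R :: "real^'n^'n" where "transpose V = V" "transpose R = R"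
    "E = 2 *\<^sub>R (V ** diag \<mu> + diag \<mu> ** V) + R"
    "(norm V)\<^sup>2 \<le> (real (card {i. \<mu> i \<noteq> 0}) - real (card {n. \<nu> n \<noteq> 0}) + 1) / 16"
    "norm R \<le> 4 / l * (norm E)\<^sup>2" "rank R \<le> card {n. \<nu> n \<noteq> 0}"
proof -
  define M where "M = W ** diag \<nu> ** transpose W"
  have M_nth: "M $ i $ j = (\<Sum>n\<in>UNIV. \<nu> n * (W $ i $ n * W $ j $ n))" for i j
    unfolding M_def by (subst matrix_matrix_mult_def) (simp add: matrix_diag_nth transpose_def mult_ac)
  have M_sym: "M $ i $ j = M $ j $ i" for i j by (simp add: M_nth mult_ac)
  have E_nth: "E $ i $ j = (if i = j then \<mu> i else 0) - M $ i $ j" for i j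
    by (simp add: E_def M_def diag_nth)
  define S where "S = {i. \<mu> i \<le> l / 2}"
  define N where "N = {n. \<nu> n \<noteq> 0}"
  have \<nu>0: "0 \<le> \<nu> n" for n using \<nu>[of n] l by auto
  have EW: "(E ** W) $ i $ n = (\<mu> i - \<nu> n) * W $ i $ n" for i n
  proof -
    have "E ** W = diag \<mu> ** W - W ** diag \<nu>"
      using W by (simp add: E_def matrix_diff_rdistrib orthogonal_matrix_def flip: matrix_mul_assoc)
    then have "(E ** W) $ i $ n = (diag \<mu> ** W) $ i $ n - (W ** diag \<nu>) $ i $ n" by simp
    then show ?thesis by (simp add: matrix_diag_nth diag_matrix_nth algebra_simps)
  qed
  have total: "(\<Sum>i\<in>UNIV. \<Sum>n\<in>UNIV. ((\<mu> i - \<nu> n) * W $ i $ n)\<^sup>2) = (norm E)\<^sup>2"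
    using norm_mult_orthogonal_matrix[OF W, of E] norm_matrix_sq[of "E ** W"] by (simp add: EW)
  define T where "T = (\<Sum>i\<in>S. \<Sum>n\<in>UNIV. \<nu> n * (W $ i $ n)\<^sup>2)"
  have gap: "\<nu> n * (W $ i $ n)\<^sup>2 \<le> 4 / l * ((\<mu> i - \<nu> n) * W $ i $ n)\<^sup>2" if "i \<in> S" for i n
  proof (cases "\<nu> n = 0")
    case False
    then have n: "l \<le> \<nu> n" using \<nu> by blast
    then have "\<nu> n / 2 \<le> \<nu> n - \<mu> i" using that by (simp add: S_def)
    then have "(\<nu> n / 2)\<^sup>2 \<le> (\<nu> n - \<mu> i)\<^sup>2" using n l by (intro power_mono) auto
    moreover have "\<nu> n * l \<le> \<nu> n * \<nu> n" using n l by (intro mult_left_mono) auto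
    ultimately have "\<nu> n * l \<le> 4 * (\<mu> i - \<nu> n)\<^sup>2"
      by (simp add: power2_commute power_divide) (simp add: power2_eq_square)
    then have "\<nu> n \<le> 4 / l * (\<mu> i - \<nu> n)\<^sup>2" using l by (simp add: field_simps)
    then show ?thesis by (metis mult.assoc mult_right_mono power_mult_distrib zero_le_power2)
  qed (use l in simp)
  have T_le: "T \<le> 4 / l * (norm E)\<^sup>2"
  proof -
    have "T \<le> (\<Sum>i\<in>S. \<Sum>n\<in>UNIV. 4 / l * ((\<mu> i - \<nu> n) * W $ i $ n)\<^sup>2)"
      unfolding T_def by (intro sum_mono gap)
    also have "\<dots> \<le> (\<Sum>i\<in>UNIV. \<Sum>n\<in>UNIV. 4 / l * ((\<mu> i - \<nu> n) * W $ i $ n)\<^sup>2)"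
      using l by (intro sum_mono2) (auto intro!: sum_nonneg)
    also have "\<dots> = 4 / l * (norm E)\<^sup>2" by (simp only: total flip: sum_distrib_left)
    finally show ?thesis .
  qed
  have T0: "0 \<le> T" unfolding T_def using \<nu>0 by (intro sum_nonneg) simp
  have E_l: "(norm E)\<^sup>2 \<le> l\<^sup>2 / 16"
    using power_mono[OF small, of 2] by (simp add: power_divide)

  have rows: "(\<Sum>n\<in>UNIV. (W $ i $ n)\<^sup>2) = 1" for i
    using W by (simp add: orthogonal_matrix_orthonormal_rows row_def norm_eq_1 inner_vec_def power2_eq_square)
  have cols: "(\<Sum>i\<in>UNIV. (W $ i $ n)\<^sup>2) = 1" for n
    using W by (simp add: orthogonal_matrix_orthonormal_columns column_def norm_eq_1 inner_vec_def power2_eq_square)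
  \<comment> \<open>The eigenvectors with nonzero eigenvalue have total weight \<open>card N\<close>; at most 1/4 of it lies
     on \<open>S\<close>, and each index outside \<open>S\<close> carries weight at most 1.\<close>
  have count: "card N \<le> card (- S)"
  proof -
    have "l * (\<Sum>i\<in>S. \<Sum>n\<in>N. (W $ i $ n)\<^sup>2) \<le> T"
    proof -
      have "l * (\<Sum>i\<in>S. \<Sum>n\<in>N. (W $ i $ n)\<^sup>2) = (\<Sum>i\<in>S. \<Sum>n\<in>N. l * (W $ i $ n)\<^sup>2)"
        by (simp add: sum_distrib_left)
      also have "\<dots> \<le> (\<Sum>i\<in>S. \<Sum>n\<in>N. \<nu> n * (W $ i $ n)\<^sup>2)"
        using \<nu> by (intro sum_mono mult_right_mono) (auto simp: N_def)
      also have "\<dots> = T" unfolding T_def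
        by (intro sum.cong sum.mono_neutral_left) (auto simp: N_def)
      finally show ?thesis .
    qed
    also have "T \<le> l / 4"
    proof -
      have "4 / l * (norm E)\<^sup>2 \<le> 4 / l * (l\<^sup>2 / 16)" using E_l l by (intro mult_left_mono) auto
      also have "\<dots> = l / 4" using l by (simp add: power2_eq_square)
      finally show ?thesis using T_le by simp
    qed
    finally have "l * (\<Sum>i\<in>S. \<Sum>n\<in>N. (W $ i $ n)\<^sup>2) \<le> l * (1 / 4)" by simp
    then have a: "(\<Sum>i\<in>S. \<Sum>n\<in>N. (W $ i $ n)\<^sup>2) \<le> 1 / 4" using l by (simp only: mult_le_cancel_left_pos)
    have "real (card N) = (\<Sum>n\<in>N. \<Sum>i\<in>UNIV. (W $ i $ n)\<^sup>2)" by (simp add: cols)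
    also have "\<dots> = (\<Sum>i\<in>UNIV. \<Sum>n\<in>N. (W $ i $ n)\<^sup>2)" by (rule sum.swap)
    also have "\<dots> = (\<Sum>i\<in>S. \<Sum>n\<in>N. (W $ i $ n)\<^sup>2) + (\<Sum>i\<in>-S. \<Sum>n\<in>N. (W $ i $ n)\<^sup>2)"
      by (subst sum.union_disjoint[symmetric]) auto
    also have "(\<Sum>i\<in>-S. \<Sum>n\<in>N. (W $ i $ n)\<^sup>2) \<le> (\<Sum>i\<in>-S. \<Sum>n\<in>UNIV. (W $ i $ n)\<^sup>2)"
      by (intro sum_mono sum_mono2) auto
    also have "\<dots> = card (- S)" by (simp add: rows)
    finally have "real (card N) \<le> 1 / 4 + card (- S)" using a by simp
    then show ?thesis by linarith
  qed

  \<comment> \<open>The surplus directions: eigenvalues of \<open>X X\<^sup>T\<close> that are small but nonzero.\<close>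
  define U where "U = {i\<in>S. \<mu> i \<noteq> 0}"
  have card_U: "real (card U) \<le> real (card {i. \<mu> i \<noteq> 0}) - real (card N)"
  proof -
    have "{i. \<mu> i \<noteq> 0} = U \<union> - S" using l by (auto simp: U_def S_def)
    moreover have "card (U \<union> - S) = card U + card (- S)"
      by (intro card_Un_disjoint) (auto simp: U_def)
    ultimately show ?thesis using count by simp
  qed

  define V :: "real^'n^'n" where "V = (\<chi> i j. if i \<in> S \<and> j \<in> S then if i = j \<and> i \<in> U then 1 / 4 else 0
      else E $ i $ j / (2 * (\<mu> i + \<mu> j)))"
  define R :: "real^'n^'n" where "R = (\<chi> i j. if i \<in> S \<and> j \<in> S then - M $ i $ j else 0)"
  have big: "l / 2 \<le> \<mu> i + \<mu> j" if "\<not> (i \<in> S \<and> j \<in> S)" for i j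
    using that \<mu>[of i] \<mu>[of j] by (auto simp: S_def)
  have E_sym: "E $ i $ j = E $ j $ i" for i j by (simp add: E_nth M_sym)
  have "transpose V = V"
    by (auto simp: V_def transpose_def vec_eq_iff E_sym add.commute)
  moreover have "transpose R = R"
    by (auto simp: R_def transpose_def vec_eq_iff M_sym)
  moreover have "E = 2 *\<^sub>R (V ** diag \<mu> + diag \<mu> ** V) + R"
  proof -
    have "E $ i $ j = 2 * (V $ i $ j * \<mu> j + \<mu> i * V $ i $ j) + R $ i $ j" for i j
    proof (cases "i \<in> S \<and> j \<in> S")
      case True
      then show ?thesis by (auto simp: V_def R_def E_nth U_def)
    next
      case False
      have "V $ i $ j * \<mu> j + \<mu> i * V $ i $ j = (\<mu> i + \<mu> j) * V $ i $ j" by (simp add: algebra_simps)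
      also have "\<dots> = E $ i $ j / 2"
        using big[OF False] l by (simp only: V_def vec_lambda_beta False if_False) (simp add: field_simps)
      finally show ?thesis using False by (auto simp: R_def)
    qed
    then show ?thesis by (simp add: vec_eq_iff matrix_diag_nth diag_matrix_nth)
  qed
  moreover have "(norm V)\<^sup>2 \<le> (real (card {i. \<mu> i \<noteq> 0}) - real (card N) + 1) / 16"
  proof -
    have entry: "(V $ i $ j)\<^sup>2 \<le> (if i = j then if i \<in> U then 1 / 16 else 0 else 0) + (E $ i $ j)\<^sup>2 / l\<^sup>2" for i j
    proof (cases "i \<in> S \<and> j \<in> S")
      case True
      then show ?thesis by (auto simp: V_def power_divide)
    next
      case False
      have "l\<^sup>2 \<le> (2 * (\<mu> i + \<mu> j))\<^sup>2" using big[OF False] l by (intro power_mono) auto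
      then have "(E $ i $ j)\<^sup>2 / (2 * (\<mu> i + \<mu> j))\<^sup>2 \<le> (E $ i $ j)\<^sup>2 / l\<^sup>2"
        using l by (intro divide_left_mono) (auto intro!: mult_pos_pos)
      then show ?thesis using False by (auto simp: V_def power_divide)
    qed
    have "(norm V)\<^sup>2 \<le> (\<Sum>i\<in>UNIV. \<Sum>j\<in>UNIV. (if i = j then if i \<in> U then 1 / 16 else 0 else 0) + (E $ i $ j)\<^sup>2 / l\<^sup>2)"
      unfolding norm_matrix_sq by (intro sum_mono entry)
    also have "\<dots> = card U / 16 + (norm E)\<^sup>2 / l\<^sup>2"
      by (simp add: sum.distrib norm_matrix_sq sum.If_cases flip: sum_divide_distrib)
    also have "(norm E)\<^sup>2 / l\<^sup>2 \<le> 1 / 16" using E_l l by (simp add: field_simps)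
    finally show ?thesis using card_U by simp
  qed
  moreover have "norm R \<le> 4 / l * (norm E)\<^sup>2"
  proof -
    define t where "t i = (\<Sum>n\<in>UNIV. \<nu> n * (W $ i $ n)\<^sup>2)" for i
    have "(M $ i $ j)\<^sup>2 \<le> t i * t j" for i j
    proof -
      \<comment> \<open>\<open>M\<close> is a Gram matrix, so the squared norm of its block is at most the square of its trace.\<close>
      have "M $ i $ j = (\<Sum>n\<in>UNIV. (sqrt (\<nu> n) * W $ i $ n) * (sqrt (\<nu> n) * W $ j $ n))"
        unfolding M_nth using \<nu>0 by (intro sum.cong) (auto simp: mult_ac simp flip: mult.assoc[of "sqrt _" "sqrt _"])
      then have "(M $ i $ j)\<^sup>2 \<le> (\<Sum>n\<in>UNIV. (sqrt (\<nu> n) * W $ i $ n)\<^sup>2) * (\<Sum>n\<in>UNIV. (sqrt (\<nu> n) * W $ j $ n)\<^sup>2)"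
        by (simp only: Cauchy_Schwarz_ineq_sum)
      then show ?thesis using \<nu>0 by (simp add: t_def power_mult_distrib)
    qed
    then have "(norm R)\<^sup>2 \<le> (\<Sum>i\<in>UNIV. \<Sum>j\<in>UNIV. if i \<in> S then if j \<in> S then t i * t j else 0 else 0)"
      unfolding norm_matrix_sq R_def by (intro sum_mono) auto
    also have "\<dots> = (\<Sum>i\<in>UNIV. if i \<in> S then (\<Sum>j\<in>UNIV. if j \<in> S then t i * t j else 0) else 0)"
      by (intro sum.cong) auto
    also have "\<dots> = (\<Sum>i\<in>S. \<Sum>j\<in>S. t i * t j)"
      by (simp add: sum.If_cases)
    also have "\<dots> = (sum t S)\<^sup>2"
      by (simp add: power2_eq_square sum_product)
    also have "sum t S = T" by (simp add: T_def t_def)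
    finally have "norm R \<le> T" using T0 by (simp add: power2_le_iff_abs_le)
    then show ?thesis using T_le by simp
  qed
  moreover have "rank R \<le> card N"
  proof -
    define P where "P = (\<lambda>i. if i \<in> S then 1 else 0 :: real)"
    have "R = - (diag P ** M ** diag P)"
      by (auto simp: vec_eq_iff R_def matrix_diag_nth diag_matrix_nth P_def)
    then have "rank R \<le> rank M"
      using order_trans[OF rank_mul_le_left[of "diag P ** M" "diag P"] rank_mul_le_right[of "diag P" M]]
      by (simp add: rank_minus)
    also have "rank M = card N" unfolding M_def N_def using W by (simp add: rank_orthogonal_conj rank_diag)
    finally show ?thesis .
  qed
  ultimately show thesis using that N_def by blast
qed

text \<open>
  Conjugation with the eigenbasis of \<open>Z\<close> preserves products, norms and ranks, so the decomposition
  carries over from the eigenbasis.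
\<close>

lemma diagonalized_residual_decomposition:
  fixes Z Zs :: "real^'n^'n"
  assumes P: "orthogonal_matrix P" and Z: "Z = P ** diag \<mu> ** transpose P"
    and Q: "orthogonal_matrix Q" and Zs: "Zs = Q ** diag \<nu> ** transpose Q"
    and \<mu>: "\<And>i. 0 \<le> \<mu> i" and l: "0 < l" and \<nu>: "\<And>n. \<nu> n = 0 \<or> l \<le> \<nu> n"
    and small: "norm (Z - Zs) \<le> l / 4"
  obtains V R where "transpose V = V" "transpose R = R"
    "Z - Zs = 2 *\<^sub>R (V ** Z + Z ** V) + R"
    "(norm V)\<^sup>2 \<le> (real (rank Z) - real (rank Zs) + 1) / 16"
    "norm R \<le> 4 / l * (norm (Z - Zs))\<^sup>2" "rank R \<le> rank Zs"
proof -
  define W where "W = transpose P ** Q"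
  have W: "orthogonal_matrix W" using P Q by (simp add: W_def orthogonal_matrix_mul)
  define c where "c A = P ** A ** transpose P" for A :: "real^'n^'n"
  have PP: "transpose P ** P = mat 1" "P ** transpose P = mat 1" using P by (auto simp: orthogonal_matrix_def)
  have c_mult: "c (A ** B) = c A ** c B" for A B
  proof -
    have "c A ** c B = P ** A ** (transpose P ** P) ** B ** transpose P"
      by (simp add: c_def matrix_mul_assoc del: PP)
    then show ?thesis by (simp add: PP c_def matrix_mul_assoc)
  qed
  have c_add: "c (A + B) = c A + c B" for A B
    by (simp add: c_def matrix_add_ldistrib matrix_add_rdistrib)
  have c_diff: "c (A - B) = c A - c B" for A B
    by (simp add: c_def matrix_diff_ldistrib matrix_diff_rdistrib)
  have c_scale: "c (2 *\<^sub>R A) = 2 *\<^sub>R c A" for A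
    by (simp only: scaleR_2 c_add)
  have c_norm: "norm (c A) = norm A" for A
    using P by (simp add: c_def norm_orthogonal_matrix_mult norm_mult_orthogonal_matrix)
  have c_rank: "rank (c A) = rank A" for A unfolding c_def by (rule rank_orthogonal_conj[OF P])
  have c_tr: "transpose (c A) = c (transpose A)" for A
    by (simp add: c_def matrix_transpose_mul matrix_mul_assoc)
  have cZ: "Z = c (diag \<mu>)" by (simp add: Z c_def)
  have "c (W ** diag \<nu> ** transpose W) = (P ** transpose P) ** Q ** diag \<nu> ** transpose Q ** (P ** transpose P)"
    by (simp add: c_def W_def matrix_transpose_mul matrix_mul_assoc)
  then have cZs: "Zs = c (W ** diag \<nu> ** transpose W)" by (simp add: PP Zs)
  define E where "E = diag \<mu> - W ** diag \<nu> ** transpose W"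
  have cE: "Z - Zs = c E" by (simp add: cZ cZs E_def c_diff)
  have "norm E \<le> l / 4" using small by (simp add: cE c_norm)
  then obtain V R where VR: "transpose V = V" "transpose R = R"
    "E = 2 *\<^sub>R (V ** diag \<mu> + diag \<mu> ** V) + R"
    "(norm V)\<^sup>2 \<le> (real (card {i. \<mu> i \<noteq> 0}) - real (card {n. \<nu> n \<noteq> 0}) + 1) / 16"
    "norm R \<le> 4 / l * (norm E)\<^sup>2" "rank R \<le> card {n. \<nu> n \<noteq> 0}"
    unfolding E_def by (rule eigenbasis_residual_decomposition[where \<mu> = \<mu> and \<nu> = \<nu>, OF W \<mu> l \<nu>])
  have ranks: "rank Z = card {i. \<mu> i \<noteq> 0}" "rank Zs = card {n. \<nu> n \<noteq> 0}"
    unfolding Z Zs using P Q by (simp_all add: rank_orthogonal_conj rank_diag)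
  show thesis
  proof (rule that[of "c V" "c R"])
    have "c E = 2 *\<^sub>R (c V ** c (diag \<mu>) + c (diag \<mu>) ** c V) + c R"
      by (subst VR(3)) (simp only: c_add c_scale c_mult)
    then show "Z - Zs = 2 *\<^sub>R (c V ** Z + Z ** c V) + c R" unfolding cE unfolding cZ .
  qed (use VR in \<open>simp_all add: c_tr c_norm c_rank ranks cE\<close>)
qed

section \<open>The damped Gauss--Newton step\<close>

text \<open>
  The damped operator is positive definite, so its inverse in the update is a true inverse.
\<close>

lemma damped_normal_equations:
  fixes J :: "'e::euclidean_space \<Rightarrow> 'y::euclidean_space"
  assumes J: "linear J" and l: "0 < l"
    and u: "u = inv (\<lambda>u. adjoint J (J u) + l *\<^sub>R u) (adjoint J v)"
  shows "J u \<bullet> J y + l * (u \<bullet> y) = v \<bullet> J y"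
proof -
  let ?T = "\<lambda>u. adjoint J (J u) + l *\<^sub>R u"
  have T: "linear ?T"
    using J adjoint_linear[OF J]
    by (intro linearI) (simp_all add: linear_add linear_scale algebra_simps)
  have "z = 0" if "?T z = 0" for z
  proof -
    have "0 = z \<bullet> ?T z" by (simp add: that)
    also have "\<dots> = J z \<bullet> J z + l * (z \<bullet> z)"
      by (simp add: inner_add_right adjoint_works[OF J])
    finally have "J z \<bullet> J z + l * (z \<bullet> z) = 0" by simp
    then have "l * (z \<bullet> z) = 0"
      using l by (smt (verit, best) inner_ge_zero mult_nonneg_nonneg)
    then show ?thesis using l by simp
  qed
  then have "inj ?T" unfolding linear_injective_0[OF T] by blast
  then have "surj ?T" by (rule linear_inj_imp_surj[OF T])
  then have "?T u = adjoint J v" unfolding u by (rule surj_f_inv_f)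
  then have "y \<bullet> ?T u = y \<bullet> adjoint J v" by simp
  then have "J y \<bullet> J u + l * (y \<bullet> u) = J y \<bullet> v"
    by (simp add: inner_add_right adjoint_works[OF J])
  then show ?thesis by (simp only: inner_commute)
qed

lemma orth_proj_subspace:
  fixes S :: "'a::euclidean_space set"
  assumes "subspace S"
  shows "orth_proj S v \<in> S" "\<And>s. s \<in> S \<Longrightarrow> (v - orth_proj S v) \<bullet> s = 0"
proof -
  let ?P = "\<lambda>p. p \<in> S \<and> (\<forall>s\<in>S. orthogonal (v - p) s)"
  obtain y z where yz: "y \<in> span S" "\<And>w. w \<in> span S \<Longrightarrow> orthogonal z w" "v = y + z"
    using orthogonal_subspace_decomp_exists by blast
  have sp: "span S = S" using assms by simp
  have y: "?P y" using yz by (auto simp: sp)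
  have "p = y" if p: "?P p" for p
  proof -
    have "p - y \<in> S" using p y assms by (simp add: subspace_diff)
    then have "(v - y) \<bullet> (p - y) = 0" "(v - p) \<bullet> (p - y) = 0"
      using p y by (auto simp: orthogonal_def)
    then have "(p - y) \<bullet> (p - y) = 0" by (simp add: inner_diff_left)
    then show ?thesis by simp
  qed
  then have "?P (orth_proj S v)" unfolding orth_proj_def by (intro theI[of ?P y, OF y])
  then show "orth_proj S v \<in> S" "\<And>s. s \<in> S \<Longrightarrow> (v - orth_proj S v) \<bullet> s = 0"
    by (auto simp: orthogonal_def)
qed

text \<open>
  The first two bounds come from testing the normal equations with \<open>u\<close> itself:
  \<open>(norm (J u))\<^sup>2 + l (norm u)\<^sup>2 = q \<bullet> J u\<close>. In the third, \<open>g\<close> is the adjoint of \<open>J\<close> applied to \<open>V\<close>;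
  on vectors \<open>J g\<close> the damped image \<open>J u\<close> differs from \<open>v\<close> only by a term of order \<open>l\<close>, however small
  the singular values of \<open>J\<close> are.
\<close>

lemma damped_step_bounds:
  fixes J :: "'e::real_inner \<Rightarrow> 'y::real_inner"
  assumes normal: "\<And>y. J u \<bullet> J y + l * (u \<bullet> y) = v \<bullet> J y" and l: "0 < l"
    and q: "q \<in> range J" "\<And>y. (v - q) \<bullet> J y = 0"
  shows "norm (J u) \<le> norm q" "l * (norm u)\<^sup>2 \<le> (norm q)\<^sup>2 / 4"
    "(\<And>y. V \<bullet> J y = g \<bullet> y) \<Longrightarrow> J g \<bullet> J u = v \<bullet> J g - l * (V \<bullet> J u)"
proof -
  let ?w = "J u"
  have "v \<bullet> ?w = q \<bullet> ?w" using q(2)[of u] by (simp add: inner_diff_left)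
  then have 1: "(norm ?w)\<^sup>2 + l * (norm u)\<^sup>2 = q \<bullet> ?w"
    using normal[of u] by (simp add: power2_norm_eq_inner)
  have 2: "q \<bullet> ?w \<le> norm q * norm ?w" by (rule norm_cauchy_schwarz)
  have "0 \<le> l * (norm u)\<^sup>2" using l by simp
  then have "norm ?w * norm ?w \<le> norm q * norm ?w" using 1 2 by (simp add: power2_eq_square)
  then show "norm ?w \<le> norm q"
    by (cases "norm ?w = 0") (auto simp: mult_le_cancel_right dest!: order.antisym)
  have "0 \<le> (norm q / 2 - norm ?w)\<^sup>2" by simp
  then show "l * (norm u)\<^sup>2 \<le> (norm q)\<^sup>2 / 4"
    using 1 2 by (simp add: power2_eq_square algebra_simps)
  show "J g \<bullet> J u = v \<bullet> J g - l * (V \<bullet> J u)" if "\<And>y. V \<bullet> J y = g \<bullet> y"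
    using normal[of g] that[of u] by (simp add: inner_commute)
qed

text \<open>
  In the expansion of the square, the alignment contributes at least \<open>2 g h\<close>, and the term
  \<open>g\<^sup>2 (norm w)\<^sup>2\<close> takes back at most \<open>\<gamma> g h\<close>, since the Polyak stepsize satisfies
  \<open>g (norm q)\<^sup>2 = \<gamma> h\<close>. The same identity, with the lower bound on the damping, bounds the second order
  correction \<open>g\<^sup>2 norm U\<close> by \<open>g h / (8 norm E)\<close>, which costs at most another \<open>g h / 4 + g h / 64\<close>.
\<close>

lemma polyak_step_descent:
  fixes E q w U :: "'y::real_inner"
  assumes w: "norm w \<le> norm q" and aligned: "h \<le> E \<bullet> w" and h: "0 < h"
    and U: "norm U \<le> (norm q)\<^sup>2 / (4 * l)"
    and l: "0 < C" "C * norm E \<le> l"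
    and \<gamma>: "0 < \<gamma>" "\<gamma> \<le> 1" "\<gamma> \<le> C / 2"
    and g: "g = \<gamma> * h / (norm q)\<^sup>2"
  shows "(norm (E - g *\<^sub>R w + g\<^sup>2 *\<^sub>R U))\<^sup>2 \<le> (norm E)\<^sup>2 - g * h / 2"
proof -
  define a b t p where "a = norm E" and "b = norm q" and "t = g * h" and "p = g\<^sup>2 * norm U"
  have "0 < norm E * norm w" using aligned h norm_cauchy_schwarz[of E w] by linarith
  then have a: "0 < a" and b: "0 < b" using w by (auto simp: a_def b_def zero_less_mult_iff)
  have hab: "h \<le> a * b"
  proof -
    have "h \<le> norm E * norm w" using aligned norm_cauchy_schwarz[of E w] by linarith
    also have "\<dots> \<le> a * b" unfolding a_def b_def using w by (intro mult_left_mono) auto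
    finally show ?thesis .
  qed
  have gb: "g * b\<^sup>2 = \<gamma> * h" using b by (simp add: g b_def)
  have g0: "0 < g" using b h \<gamma> by (simp add: g b_def)
  have t0: "0 < t" using g0 h by (simp add: t_def)
  have t_a: "t \<le> a\<^sup>2"
  proof -
    have "h * h \<le> (a * b) * (a * b)" using hab h by (intro mult_mono) auto
    then have "\<gamma> * (h * h) \<le> (a * b) * (a * b)"
      using mult_right_mono[OF \<gamma>(2), of "h * h"] by simp
    moreover have "t * b\<^sup>2 = \<gamma> * (h * h)"
    proof -
      have "t * b\<^sup>2 = (g * b\<^sup>2) * h" by (simp add: t_def)
      then show ?thesis by (simp add: gb)
    qed
    ultimately have "t * b\<^sup>2 \<le> a\<^sup>2 * b\<^sup>2" by (simp add: power2_eq_square mult_ac)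
    then show ?thesis using b by simp
  qed
  have p0: "0 \<le> p" by (simp add: p_def)
  have p: "p * a \<le> t / 8"
  proof -
    have l0: "0 < l" using l a by (metis a_def less_le_trans mult_pos_pos)
    have "p \<le> g\<^sup>2 * (b\<^sup>2 / (4 * l))" unfolding p_def b_def using U by (intro mult_left_mono) auto
    also have "\<dots> = g * (g * b\<^sup>2) / (4 * l)" by (simp add: power2_eq_square)
    also have "\<dots> = t * \<gamma> / (4 * l)" by (simp add: gb t_def)
    finally have "p * a \<le> t * \<gamma> / (4 * l) * a" using a by (intro mult_right_mono) auto
    also have "\<dots> = t * (\<gamma> * a) / (4 * l)" by simp
    also have "\<dots> \<le> t * (l / 2) / (4 * l)"
    proof -
      have "\<gamma> * a \<le> C / 2 * a" using \<gamma> a by (intro mult_right_mono) auto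
      also have "\<dots> \<le> l / 2" using l by (simp add: a_def)
      finally show ?thesis using t0 l0 by (intro divide_right_mono mult_left_mono) auto
    qed
    also have "\<dots> = t / 8" using l0 by simp
    finally show ?thesis .
  qed
  have pp: "p\<^sup>2 \<le> t / 64"
  proof -
    have "(p * a)\<^sup>2 \<le> (t / 8)\<^sup>2" using p p0 a by (intro power_mono) auto
    then have "p\<^sup>2 * a\<^sup>2 \<le> t * t / 64" by (simp only: power_mult_distrib power_divide) (simp add: power2_eq_square)
    also have "\<dots> \<le> t / 64 * a\<^sup>2" using t_a t0 by (simp add: mult_left_mono)
    finally show ?thesis using a by (simp add: mult_le_cancel_right)
  qed
  define A where "A = norm (E - g *\<^sub>R w)"
  have A2: "A\<^sup>2 \<le> a\<^sup>2 - t"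
  proof -
    have "A\<^sup>2 = a\<^sup>2 - 2 * g * (E \<bullet> w) + g\<^sup>2 * (norm w)\<^sup>2"
      unfolding A_def a_def power2_norm_eq_inner
      by (simp add: inner_diff_left inner_diff_right inner_commute[of w E]) (simp add: power2_eq_square algebra_simps)
    also have "\<dots> \<le> a\<^sup>2 - 2 * t + t"
    proof -
      have "g * h \<le> g * (E \<bullet> w)" using aligned g0 by simp
      moreover have "g\<^sup>2 * (norm w)\<^sup>2 \<le> t"
      proof -
        have "g\<^sup>2 * (norm w)\<^sup>2 \<le> g\<^sup>2 * b\<^sup>2" using w unfolding b_def by (intro mult_left_mono power_mono) auto
        also have "\<dots> = \<gamma> * t" using gb by (simp add: power2_eq_square t_def mult_ac)
        also have "\<dots> \<le> t" using \<gamma> t0 by simp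
        finally show ?thesis .
      qed
      ultimately show ?thesis by (simp add: t_def)
    qed
    finally show ?thesis by simp
  qed
  have Aa: "A \<le> a" using A2 t0 a by (smt (verit) power2_le_imp_le)
  have "norm (E - g *\<^sub>R w + g\<^sup>2 *\<^sub>R U) \<le> A + p"
    unfolding A_def p_def by (rule order_trans[OF norm_triangle_ineq]) simp
  then have "(norm (E - g *\<^sub>R w + g\<^sup>2 *\<^sub>R U))\<^sup>2 \<le> (A + p)\<^sup>2" by (intro power_mono) auto
  also have "\<dots> = A\<^sup>2 + 2 * (A * p) + p\<^sup>2" by (simp add: power2_eq_square algebra_simps)
  also have "A * p \<le> p * a" using mult_right_mono[OF Aa p0] by (simp add: mult.commute)
  finally show ?thesis using A2 p pp t0 unfolding t_def a_def by linarith
qed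

section \<open>The Gram map\<close>

lift_definition gram_deriv :: "real^'r^'d \<Rightarrow> real^'r^'d \<Rightarrow> 'd::finite sym_mat"
  is "\<lambda>X u. X ** transpose u + u ** transpose X"
  by (simp add: vec_eq_iff transpose_def matrix_matrix_mult_def mult.commute add.commute)

lemma gram_add: "gram (X + u) = gram X + gram_deriv X u + gram u"
  by transfer (simp add: vec_eq_iff transpose_def matrix_matrix_mult_def algebra_simps sum.distrib)

lemma linear_gram_deriv: "linear (gram_deriv X)"
  by (rule linearI; transfer)
     (simp_all add: vec_eq_iff transpose_def matrix_matrix_mult_def algebra_simps sum.distrib sum_distrib_left)

lemma gram_scaleR: "gram (c *\<^sub>R u) = c\<^sup>2 *\<^sub>R gram u"
  by transfer (simp add: vec_eq_iff transpose_def matrix_matrix_mult_def sum_distrib_left power2_eq_square mult_ac)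

text \<open>
  Each entry is an inner product of two rows, to which the Cauchy--Schwarz inequality applies.
\<close>

lemma norm_gram_le: "norm (gram u) \<le> (norm u)\<^sup>2"
proof -
  have "(norm (u ** transpose u))\<^sup>2 \<le> (\<Sum>i\<in>UNIV. \<Sum>j\<in>UNIV. (norm (u $ i))\<^sup>2 * (norm (u $ j))\<^sup>2)"
    unfolding norm_matrix_sq
  proof (intro sum_mono)
    fix i j
    have "(u ** transpose u) $ i $ j = u $ i \<bullet> u $ j"
      by (simp add: matrix_matrix_mult_def transpose_def inner_vec_def)
    then show "((u ** transpose u) $ i $ j)\<^sup>2 \<le> (norm (u $ i))\<^sup>2 * (norm (u $ j))\<^sup>2"
      using Cauchy_Schwarz_ineq[of "u $ i" "u $ j"] by (simp add: power2_norm_eq_inner)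
  qed
  also have "\<dots> = (\<Sum>i\<in>UNIV. (norm (u $ i))\<^sup>2)\<^sup>2"
    by (simp only: power2_eq_square[of "sum _ _"] sum_product)
  also have "(\<Sum>i\<in>UNIV. (norm (u $ i))\<^sup>2) = (norm u)\<^sup>2"
    unfolding power2_norm_eq_inner by (rule inner_vec_def[symmetric])
  finally have "norm (u ** transpose u) \<le> (norm u)\<^sup>2" by (rule power2_le_imp_le) simp
  then show ?thesis by transfer
qed

lemma gram_has_derivative: "(gram has_derivative gram_deriv X) (at X)"
proof -
  have "(\<lambda>y. norm (gram y - gram X - gram_deriv X (y - X)) / norm (y - X)) \<midarrow>X\<rightarrow> 0"
  proof (rule tendsto_sandwich[of "\<lambda>_. 0" _ _ "\<lambda>y. norm (y - X)"])
    have "norm (gram y - gram X - gram_deriv X (y - X)) / norm (y - X) \<le> norm (y - X)" for y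
    proof -
      have "gram y - gram X - gram_deriv X (y - X) = gram (y - X)"
        using gram_add[of X "y - X"] by simp
      then show ?thesis using norm_gram_le[of "y - X"] by (simp add: divide_le_eq power2_eq_square)
    qed
    then show "\<forall>\<^sub>F y in at X. norm (gram y - gram X - gram_deriv X (y - X)) / norm (y - X) \<le> norm (y - X)"
      by simp
    show "(\<lambda>y. norm (y - X)) \<midarrow>X\<rightarrow> 0" by (rule LIM_offset_zero_cancel) (auto intro!: tendsto_eq_intros)
  qed auto
  then show ?thesis
    using linear_gram_deriv by (simp add: has_derivative_iff_norm linear_linear has_derivative_at_within)
qed

lemma frechet_derivative_gram: "frechet_derivative gram (at X) = gram_deriv X"
  by (rule frechet_derivative_at[OF gram_has_derivative, symmetric])

text \<open>
  The adjoint of the derivative at \<open>X\<close> is \<open>V \<mapsto> 2 V X\<close>.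
\<close>

lemma inner_gram_deriv: "V \<bullet> gram_deriv X y = (2 *\<^sub>R (mat_of V ** X)) \<bullet> y"
proof -
  let ?V = "mat_of V"
  have sym: "?V $ i $ j = ?V $ j $ i" for i j
    using arg_cong[OF transpose_mat_of[of V], of "\<lambda>M. M $ i $ j"] by (simp add: transpose_def del: transpose_mat_of)
  have 1: "?V \<bullet> (y ** transpose X) = (?V ** X) \<bullet> y"
  proof -
    have "(\<Sum>j\<in>UNIV. ?V $ i $ j * (\<Sum>k\<in>UNIV. y $ i $ k * X $ j $ k))
        = (\<Sum>k\<in>UNIV. (\<Sum>j\<in>UNIV. ?V $ i $ j * X $ j $ k) * y $ i $ k)" for i
      unfolding sum_distrib_left sum_distrib_right by (subst sum.swap) (simp add: mult_ac)
    then show ?thesis by (simp add: inner_vec_def matrix_matrix_mult_def transpose_def)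
  qed
  have "?V \<bullet> (X ** transpose y) = ?V \<bullet> (y ** transpose X)"
    unfolding inner_vec_def
    by (subst (2) sum.swap) (simp add: sym matrix_matrix_mult_def transpose_def inner_vec_def mult_ac cong: sum.cong)
  then show ?thesis using 1
    by (simp add: inner_sym_mat.rep_eq gram_deriv.rep_eq inner_add_right)
qed

lemma rank_gram: "rank (mat_of (gram (X :: real^'r^'d))) \<le> CARD('r)"
  by (simp add: gram.rep_eq rank_mult_le_inner_dim)

lemma rank_gram_deriv: "rank (mat_of (gram_deriv (X :: real^'r^'d) u)) \<le> 2 * CARD('r)"
  unfolding gram_deriv.rep_eq
  using rank_add_le[of "X ** transpose u" "u ** transpose X"] rank_mult_le_inner_dim[of X "transpose u"] rank_mult_le_inner_dim[of u "transpose X"]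
  by linarith

lemma psd_gram: "psd (gram X)"
  unfolding psd_def gram.rep_eq
  by (metis dot_lmul_matrix inner_ge_zero matrix_vector_mul_assoc vector_transpose_matrix transpose_transpose)

lemma psd_diagonalization:
  fixes Z :: "'d::finite sym_mat"
  assumes "psd Z"
  obtains Q \<mu> where "orthogonal_matrix Q" "mat_of Z = Q ** diag \<mu> ** transpose Q" "\<And>i. 0 \<le> \<mu> i"
proof -
  obtain Q \<mu> where Q: "orthogonal_matrix Q" and Z: "mat_of Z = Q ** diag \<mu> ** transpose Q"
    using symmetric_matrix_diagonalization[OF transpose_mat_of] .
  have ZQ: "mat_of Z ** Q = Q ** diag \<mu>"
    using Q by (simp add: Z orthogonal_matrix_def flip: matrix_mul_assoc)
  have "0 \<le> \<mu> i" for i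
  proof -
    have "mat_of Z *v column i Q = column i (mat_of Z ** Q)"
      by (simp add: column_def matrix_matrix_mult_def matrix_vector_mult_def)
    also have "\<dots> = \<mu> i *\<^sub>R column i Q"
      unfolding ZQ by (simp add: column_def matrix_diag_nth vec_eq_iff)
    finally have "column i Q \<bullet> (mat_of Z *v column i Q) = \<mu> i"
      using Q by (simp add: orthogonal_matrix_orthonormal_columns norm_eq_1)
    then show ?thesis using assms by (metis psd_def)
  qed
  then show thesis using that Q Z by blast
qed

text \<open>
  A factor is \<open>Q H\<close>, where \<open>H\<close> places the square roots of the nonzero eigenvalues into distinct
  columns; there are enough columns by the bound on the rank.
\<close>

lemma psd_in_range_gram:
  fixes Z :: "'d::finite sym_mat"
  assumes "psd Z" and rank: "rank (mat_of Z) \<le> CARD('r)"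
  shows "Z \<in> range (gram :: real^'r^'d \<Rightarrow> 'd sym_mat)"
proof -
  obtain Q \<nu> where Q: "orthogonal_matrix Q" and Z: "mat_of Z = Q ** diag \<nu> ** transpose Q"
    and \<nu>: "\<And>i. 0 \<le> \<nu> i"
    using psd_diagonalization[OF \<open>psd Z\<close>] by blast
  define S where "S = {n. \<nu> n \<noteq> 0}"
  have "card S \<le> card (UNIV :: 'r set)"
    using rank by (simp add: Z rank_orthogonal_conj[OF Q] rank_diag S_def)
  then obtain f :: "'d \<Rightarrow> 'r" where f: "inj_on f S"
    using card_le_inj[of S "UNIV :: 'r set"] by auto
  define H :: "real^'r^'d" where "H = (\<chi> n k. if n \<in> S \<and> f n = k then sqrt (\<nu> n) else 0)"
  have "(H ** transpose H) $ m $ n = diag \<nu> $ m $ n" for m n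
  proof -
    have "H $ m $ k * H $ n $ k = (if k = f m then if m \<in> S \<and> n \<in> S \<and> f n = f m then sqrt (\<nu> m) * sqrt (\<nu> n) else 0 else 0)" for k
      by (auto simp: H_def)
    then have "(H ** transpose H) $ m $ n = (\<Sum>k\<in>UNIV. if k = f m then if m \<in> S \<and> n \<in> S \<and> f n = f m then sqrt (\<nu> m) * sqrt (\<nu> n) else 0 else 0)"
      by (simp add: matrix_matrix_mult_def transpose_def)
    also have "\<dots> = (if m \<in> S \<and> n \<in> S \<and> f n = f m then sqrt (\<nu> m) * sqrt (\<nu> n) else 0)"
      by simp
    also have "\<dots> = diag \<nu> $ m $ n"
      using f \<nu> by (auto simp: diag_nth S_def inj_on_def)
    finally show ?thesis .
  qed
  then have H: "H ** transpose H = diag \<nu>" by (simp add: vec_eq_iff)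
  have "mat_of (gram (Q ** H)) = Q ** (H ** transpose H) ** transpose Q"
    by (simp add: gram.rep_eq matrix_transpose_mul matrix_mul_assoc)
  then have "gram (Q ** H) = Z" by (simp add: H Z flip: mat_of_inject)
  then show ?thesis by blast
qed

text \<open>
  The first summand is \<open>J J\<^sup>T V\<close>, as \<open>2 V X\<close> is the adjoint of the derivative \<open>J\<close> applied to \<open>V\<close>.
  The matrix \<open>X X\<^sup>T\<close> has at most as many nonzero eigenvalues as \<open>X\<close> has columns, which gives the bound
  on \<open>V\<close>.
\<close>

lemma gram_residual_decomposition:
  fixes X :: "real^'r^'d" and Zs :: "'d::finite sym_mat"
  defines "E \<equiv> gram X - Zs" and "l \<equiv> eigval (rank (mat_of Zs)) Zs"
  assumes "psd Zs" and l: "0 < l" and small: "norm E \<le> l / 4"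
  obtains V R where "E = gram_deriv X (2 *\<^sub>R (mat_of V ** X)) + R"
    "norm V \<le> sqrt (real CARD('r) - real (rank (mat_of Zs)) + 1) / 4"
    "norm R \<le> 4 / l * (norm E)\<^sup>2" "rank (mat_of R) \<le> rank (mat_of Zs)"
proof -
  obtain P \<mu> where P: "orthogonal_matrix P" "mat_of (gram X) = P ** diag \<mu> ** transpose P" "\<And>i. 0 \<le> \<mu> i"
    using psd_diagonalization[OF psd_gram] by blast
  obtain Q \<nu> where Q: "orthogonal_matrix Q" "mat_of Zs = Q ** diag \<nu> ** transpose Q" "\<And>i. 0 \<le> \<nu> i"
    using psd_diagonalization[OF \<open>psd Zs\<close>] by blast
  have \<nu>: "\<nu> n = 0 \<or> l \<le> \<nu> n" for n
    using eigval_rank_le[OF Q(1,2), of n] Q(3)[of n] by (auto simp: l_def less_le)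
  let ?Z = "mat_of (gram X)"
  have nE: "norm (?Z - mat_of Zs) = norm E"
    by (simp add: E_def norm_sym_mat.rep_eq minus_sym_mat.rep_eq)
  obtain V R where VR: "transpose V = V" "transpose R = R"
    "?Z - mat_of Zs = 2 *\<^sub>R (V ** ?Z + ?Z ** V) + R"
    "(norm V)\<^sup>2 \<le> (real (rank ?Z) - real (rank (mat_of Zs)) + 1) / 16"
    "norm R \<le> 4 / l * (norm (?Z - mat_of Zs))\<^sup>2" "rank R \<le> rank (mat_of Zs)"
    by (rule diagonalized_residual_decomposition[OF P(1,2) Q(1,2) P(3) l \<nu>]) (use small nE in auto)
  show thesis
  proof (rule that[of "Sym_mat V" "Sym_mat R"])
    have m: "mat_of (Sym_mat V) = V" "mat_of (Sym_mat R) = R"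
      using VR(1,2) by (auto intro: Sym_mat_inverse)
    have "X ** transpose (2 *\<^sub>R (V ** X)) = 2 *\<^sub>R (?Z ** V)"
      using VR(1) by (simp add: gram.rep_eq transpose_scalar matrix_transpose_mul matrix_mul_assoc matrix_scalar_ac scalar_matrix_assoc)
    moreover have "2 *\<^sub>R (V ** X) ** transpose X = 2 *\<^sub>R (V ** ?Z)"
      by (simp add: gram.rep_eq matrix_mul_assoc flip: scalar_matrix_assoc)
    ultimately have "mat_of E = mat_of (gram_deriv X (2 *\<^sub>R (mat_of (Sym_mat V) ** X)) + Sym_mat R)"
      using VR(3) by (simp add: E_def gram_deriv.rep_eq plus_sym_mat.rep_eq minus_sym_mat.rep_eq m scaleR_add_right add_ac)
    then show "E = gram_deriv X (2 *\<^sub>R (mat_of (Sym_mat V) ** X)) + Sym_mat R"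
      by (simp only: mat_of_inject)
    have "(norm V)\<^sup>2 \<le> (real CARD('r) - real (rank (mat_of Zs)) + 1) / 16"
      using VR(4) rank_gram[of X] by simp
    then have "norm V \<le> sqrt ((real CARD('r) - real (rank (mat_of Zs)) + 1) / 16)"
      by (rule real_le_rsqrt)
    also have "\<dots> = sqrt (real CARD('r) - real (rank (mat_of Zs)) + 1) / 4"
      by (simp add: real_sqrt_divide)
    finally show "norm (Sym_mat V) \<le> sqrt (real CARD('r) - real (rank (mat_of Zs)) + 1) / 4"
      by (simp add: norm_sym_mat.rep_eq m)
    show "norm (Sym_mat R) \<le> 4 / l * (norm E)\<^sup>2" "rank (mat_of (Sym_mat R)) \<le> rank (mat_of Zs)"
      using VR(5,6) by (simp_all add: norm_sym_mat.rep_eq m nE)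
  qed
qed

section \<open>The sensing loss under restricted isometry\<close>

lemma gradient_sensing_loss:
  fixes \<A> :: "'d::finite sym_mat \<Rightarrow> real^'m"
  assumes "linear \<A>"
  shows "gradient (sensing_loss \<A> b) Z \<bullet> y = 2 * ((\<A> Z - b) \<bullet> \<A> y)"
proof -
  have bl: "bounded_linear \<A>" using assms by (simp add: linear_linear)
  let ?v = "2 *\<^sub>R adjoint \<A> (\<A> Z - b)"
  have adj: "?v \<bullet> y = 2 * ((\<A> Z - b) \<bullet> \<A> y)" for y
    using adjoint_works[OF assms, of y "\<A> Z - b"] by (simp add: inner_commute)
  have "((\<lambda>Z. (\<A> Z - b) \<bullet> (\<A> Z - b)) has_derivative (\<lambda>y. y \<bullet> ?v)) (at Z)"
    by (rule derivative_eq_intros bounded_linear.has_derivative[OF bl] refl)+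
       (simp add: fun_eq_iff adjoint_works[OF assms] inner_commute[of "\<A> Z - b"])
  then have D: "GDERIV (sensing_loss \<A> b) Z :> ?v"
    by (simp add: gderiv_def sensing_loss_def[abs_def] power2_norm_eq_inner)
  have "v = ?v" if "GDERIV (sensing_loss \<A> b) Z :> v" for v
  proof -
    have "(\<lambda>h. h \<bullet> v) = (\<lambda>h. h \<bullet> ?v)"
      using that D unfolding gderiv_def by (rule has_derivative_unique)
    then have "(v - ?v) \<bullet> v = (v - ?v) \<bullet> ?v" by (rule fun_cong)
    then have "(v - ?v) \<bullet> (v - ?v) = 0" by (simp add: inner_diff_right)
    then show ?thesis by simp
  qed
  then have "gradient (sensing_loss \<A> b) Z = ?v"
    unfolding gradient_def using D by (intro the_equality)
  then show ?thesis using adj by simp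
qed

definition restricted_isometry :: "nat \<Rightarrow> real \<Rightarrow> ('d::finite sym_mat \<Rightarrow> real^'m) \<Rightarrow> bool"
  where "restricted_isometry k \<delta> \<A> \<longleftrightarrow> (\<forall>Z. rank (mat_of Z) \<le> k \<longrightarrow>
    (1 - \<delta>) * (norm Z)\<^sup>2 \<le> (norm (\<A> Z))\<^sup>2 \<and> (norm (\<A> Z))\<^sup>2 \<le> (1 + \<delta>) * (norm Z)\<^sup>2)"

lemma rank_gram_diff:
  "rank (mat_of (gram (X :: real^'r^'d) - Zs)) \<le> CARD('r) + rank (mat_of Zs)"
proof -
  have "mat_of (gram X - Zs) = mat_of (gram X) + - mat_of Zs" by (simp add: minus_sym_mat.rep_eq)
  then show ?thesis
    using rank_add_le[of "mat_of (gram X)" "- mat_of Zs"] rank_gram[of X] by (simp add: rank_minus)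
qed

text \<open>
  The loss vanishes at the ground truth, which is a Gram matrix. Every Gram matrix differs from it by
  a matrix of low rank, on which restricted isometry makes the measurement injective.
\<close>

lemma sensing_minimizers:
  fixes \<A> :: "'d::finite sym_mat \<Rightarrow> real^'m"
  assumes "linear \<A>" and rip: "restricted_isometry (6 * CARD('r)) \<delta> \<A>" and "\<delta> < 1"
    and "psd Zs" and rank: "rank (mat_of Zs) \<le> CARD('r)"
  shows "minimizers (sensing_loss \<A> (\<A> Zs)) (range (gram :: real^'r^'d \<Rightarrow> _)) = {Zs}"
    and "(INF Z\<in>range (gram :: real^'r^'d \<Rightarrow> _). sensing_loss \<A> (\<A> Zs) Z) = 0"
proof -
  let ?h = "sensing_loss \<A> (\<A> Zs)" and ?G = "range (gram :: real^'r^'d \<Rightarrow> _)"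
  have Zs: "Zs \<in> ?G" using assms by (intro psd_in_range_gram) auto
  have h0: "?h Zs = 0" and hpos: "0 \<le> ?h Z" for Z by (auto simp: sensing_loss_def)
  have inj: "Z = Zs" if Z: "Z \<in> ?G" "?h Z = 0" for Z
  proof -
    obtain X :: "real^'r^'d" where X: "Z = gram X" using Z(1) by blast
    have "rank (mat_of (gram X - Zs)) \<le> 6 * CARD('r)"
      using rank_gram_diff[of X Zs] rank by simp
    then have "(1 - \<delta>) * (norm (Z - Zs))\<^sup>2 \<le> (norm (\<A> (Z - Zs)))\<^sup>2"
      using rip unfolding restricted_isometry_def X by blast
    also have "\<dots> = 0" using Z(2) \<open>linear \<A>\<close> by (simp add: sensing_loss_def linear_diff)
    finally show ?thesis using \<open>\<delta> < 1\<close> by (simp add: mult_le_0_iff)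
  qed
  show "minimizers ?h ?G = {Zs}"
  proof (intro set_eqI iffI)
    fix Z assume "Z \<in> minimizers ?h ?G"
    then have "Z \<in> ?G" "\<not> ?h Zs < ?h Z" using Zs by (auto simp: minimizers_def is_arg_min_def)
    then show "Z \<in> {Zs}" using inj h0 hpos[of Z] by fastforce
  next
    fix Z assume "Z \<in> {Zs}"
    then show "Z \<in> minimizers ?h ?G" using Zs h0 hpos by (auto simp: minimizers_def is_arg_min_def not_less)
  qed
  have "(INF Z\<in>?G. ?h Z) \<le> ?h Zs"
    using Zs hpos by (intro cINF_lower) (auto intro!: bdd_belowI2[where m = 0])
  moreover have "0 \<le> (INF Z\<in>?G. ?h Z)"
    using hpos by (intro cINF_greatest) auto
  ultimately show "(INF Z\<in>?G. ?h Z) = 0" using h0 by simp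
qed

section \<open>Contraction and linear convergence\<close>

lemma ratio_bounds:
  fixes \<delta> :: real
  assumes \<delta>: "0 < \<delta>" "\<delta> < 1"
  shows "0 < (1 - \<delta>)\<^sup>2 / (1 + \<delta>)\<^sup>2" "(1 - \<delta>)\<^sup>2 / (1 + \<delta>)\<^sup>2 \<le> 1"
    "(1 - \<delta>)\<^sup>2 / (1 + \<delta>)\<^sup>2 * (1 + \<delta>) \<le> 1 - \<delta>"
proof -
  have "(1 - \<delta>) * (1 - \<delta>) \<le> (1 - \<delta>) * (1 + \<delta>)" using \<delta> by (intro mult_left_mono) auto
  then show "(1 - \<delta>)\<^sup>2 / (1 + \<delta>)\<^sup>2 * (1 + \<delta>) \<le> 1 - \<delta>"
    using \<delta> by (simp add: power2_eq_square divide_simps)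
qed (use \<delta> in \<open>auto simp: divide_le_eq_1 power_mono\<close>)

text \<open>
  In the alignment estimate, \<open>s\<close> is the square root of the loss, \<open>e\<close> the norm of the residual and
  \<open>m\<close> the size of the decomposition errors, which enter with the factor \<open>2 sqrt (1 + \<delta>) * s\<close>. As
  \<open>\<kappa>\<close> is at most \<open>(1 - \<delta>) / (1 + \<delta>)\<close>, errors proportional to \<open>\<kappa> e\<close> cost at most half of the
  available \<open>2 s\<^sup>2\<close>.
\<close>

lemma isometry_absorbs_error:
  fixes \<delta> e m s n :: real
  defines "\<kappa> \<equiv> (1 - \<delta>)\<^sup>2 / (1 + \<delta>)\<^sup>2"
  assumes \<delta>: "0 < \<delta>" "\<delta> < 1"
    and s: "(1 - \<delta>) * e\<^sup>2 \<le> s\<^sup>2" "0 \<le> s" and e: "0 \<le> e" and m: "0 \<le> m" "m \<le> \<kappa> * e * (2 / 5)"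
  shows "2 * sqrt (1 + \<delta>) * s * m \<le> s\<^sup>2"
proof -
  note k = ratio_bounds[OF \<delta>, folded \<kappa>_def]
  have "(2 * sqrt (1 + \<delta>) * m)\<^sup>2 \<le> s\<^sup>2"
  proof -
    have "(2 * sqrt (1 + \<delta>) * m)\<^sup>2 = 4 * (1 + \<delta>) * m\<^sup>2" using \<delta> by (simp add: power_mult_distrib)
    also have "m\<^sup>2 \<le> (\<kappa> * e * (2 / 5))\<^sup>2" using m by (intro power_mono) auto
    also have "4 * (1 + \<delta>) * (\<kappa> * e * (2 / 5))\<^sup>2 = 16 / 25 * (\<kappa> * (1 + \<delta>)) * \<kappa> * e\<^sup>2"
      by (simp add: power2_eq_square)
    also have "\<dots> \<le> 1 * (1 - \<delta>) * 1 * e\<^sup>2"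
      using k \<delta> by (intro mult_mono) auto
    finally show ?thesis using s \<delta> by simp
  qed
  then have "2 * sqrt (1 + \<delta>) * m \<le> s" using s(2) by (rule power2_le_imp_le)
  from mult_right_mono[OF this \<open>0 \<le> s\<close>] show ?thesis by (simp add: power2_eq_square mult_ac)
qed

text \<open>
  With \<open>E = J y + R\<close> and \<open>y = J\<^sup>T V\<close>, the alignment splits as
  \<open>E \<bullet> w = 2 s\<^sup>2 - v \<bullet> R - l (V \<bullet> w) + R \<bullet> w\<close>, where \<open>s\<^sup>2\<close> is the loss and \<open>2 s\<^sup>2 = v \<bullet> E\<close>. The vectors
  \<open>w\<close> and, on matrices of low rank, \<open>v\<close> are bounded by \<open>2 sqrt (1 + \<delta>) s\<close>. The error terms therefore
  leave at least \<open>s\<^sup>2\<close>, and \<open>polyak_step_descent\<close> applies.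
\<close>

lemma lmm_step_contraction:
  fixes \<A> :: "'d::finite sym_mat \<Rightarrow> real^'m" and X :: "real^'r^'d" and Zs :: "'d sym_mat"
    and \<delta> \<gamma> g l C D :: real
  defines "h \<equiv> sensing_loss \<A> (\<A> Zs)"
  defines "q \<equiv> orth_proj (range (gram_deriv X)) (gradient h (gram X))"
  defines "\<kappa> \<equiv> (1 - \<delta>)\<^sup>2 / (1 + \<delta>)\<^sup>2" and "r' \<equiv> rank (mat_of Zs)"
  assumes lin: "linear \<A>" and rip: "restricted_isometry (6 * CARD('r)) \<delta> \<A>"
    and \<delta>: "0 < \<delta>" "\<delta> < 1"
    and psd: "psd Zs" and r': "r' \<le> CARD('r)"
    and ne: "gram X \<noteq> Zs"
    and small: "norm (gram X - Zs) \<le> 1 / (16 * sqrt 2) * \<kappa> * eigval r' Zs"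
    and \<gamma>: "0 < \<gamma>" "\<gamma> \<le> 1" "\<gamma> \<le> C / 2"
    and g: "g = \<gamma> * h (gram X) / (norm q)\<^sup>2"
    and l: "0 < C" "C * norm (gram X - Zs) \<le> l" "l \<le> D * norm (gram X - Zs)"
    and D: "D \<le> 1 / (64 * sqrt (2 * (real CARD('r) - real r' + 1))) * \<kappa>\<^sup>2"
  shows "(norm (gram (lmm_step gram h g l X) - Zs))\<^sup>2
    \<le> (1 - \<gamma> / 32 * \<kappa>) * (norm (gram X - Zs))\<^sup>2"
proof -
  define E where "E = gram X - Zs"
  define v where "v = gradient h (gram X)"
  define s where "s = norm (\<A> E)"
  define e where "e = norm E"
  define lam where "lam = eigval r' Zs"
  let ?J = "gram_deriv X"
  have e: "0 < e" using ne by (simp add: e_def E_def)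
  note \<kappa> = ratio_bounds(1,2)[OF \<delta>, folded \<kappa>_def]
  have l0: "0 < l" using l e by (metis E_def e_def less_le_trans mult_pos_pos)
  have hs: "h (gram X) = s\<^sup>2"
    using lin by (simp add: h_def sensing_loss_def s_def E_def linear_diff)
  have v: "v \<bullet> y = 2 * (\<A> E \<bullet> \<A> y)" for y
    using gradient_sensing_loss[OF lin, of "\<A> Zs" "gram X" y] lin
    by (simp add: v_def h_def E_def linear_diff)
  have ripD: "(1 - \<delta>) * (norm Z)\<^sup>2 \<le> (norm (\<A> Z))\<^sup>2" "norm (\<A> Z) \<le> sqrt (1 + \<delta>) * norm Z"
    if "rank (mat_of Z) \<le> 6 * CARD('r)" for Z
  proof -
    have "(norm (\<A> Z))\<^sup>2 \<le> (1 + \<delta>) * (norm Z)\<^sup>2"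
      using rip that by (simp add: restricted_isometry_def)
    then have "norm (\<A> Z) \<le> sqrt ((1 + \<delta>) * (norm Z)\<^sup>2)" by (rule real_le_rsqrt)
    then show "norm (\<A> Z) \<le> sqrt (1 + \<delta>) * norm Z" by (simp add: real_sqrt_mult)
  qed (use rip that in \<open>simp add: restricted_isometry_def\<close>)
  have s_e: "(1 - \<delta>) * e\<^sup>2 \<le> s\<^sup>2"
    unfolding e_def s_def using rank_gram_diff[of X Zs] r' by (intro ripD(1)) (simp add: E_def r'_def)
  have s0: "0 < s"
  proof -
    have "0 < (1 - \<delta>) * e\<^sup>2" using e \<delta> by simp
    then have "0 < s\<^sup>2" using s_e by linarith
    then show ?thesis by (simp add: s_def)
  qed

  have q_in: "q \<in> range ?J" and q_orth: "(v - q) \<bullet> ?J y = 0" for y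
    using orth_proj_subspace[where S = "range ?J" and v = v, OF linear_subspace_image[OF linear_gram_deriv subspace_UNIV]]
    by (auto simp: q_def v_def)
  have q_le: "norm q \<le> 2 * sqrt (1 + \<delta>) * s"
  proof -
    have "(norm q)\<^sup>2 = v \<bullet> q"
      using q_in q_orth by (auto simp: power2_norm_eq_inner inner_diff_left)
    also have "\<dots> \<le> 2 * (s * norm (\<A> q))"
      unfolding v s_def using norm_cauchy_schwarz[of "\<A> E" "\<A> q"] by simp
    also have "norm (\<A> q) \<le> sqrt (1 + \<delta>) * norm q"
    proof (rule ripD(2))
      obtain y where "q = ?J y" using q_in by blast
      then show "rank (mat_of q) \<le> 6 * CARD('r)" using rank_gram_deriv[of X y] by simp
    qed
    finally have "norm q * norm q \<le> (2 * sqrt (1 + \<delta>) * s) * norm q"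
      using s0 by (simp add: power2_eq_square mult_ac)
    then show ?thesis using s0 \<delta> by (cases "norm q = 0") (auto simp: mult_le_cancel_right)
  qed

  define u where "u = inv (\<lambda>u. adjoint ?J (?J u) + l *\<^sub>R u) (adjoint ?J v)"
  have step: "lmm_step gram h g l X = X - g *\<^sub>R u"
    by (simp add: lmm_step_def Let_def frechet_derivative_gram u_def v_def)
  have normal: "?J u \<bullet> ?J y + l * (u \<bullet> y) = v \<bullet> ?J y" for y
    using linear_gram_deriv l0 u_def by (rule damped_normal_equations)
  note bounds = damped_step_bounds[of ?J u l v q, OF normal l0 q_in q_orth]

  have aligned: "h (gram X) \<le> E \<bullet> ?J u"
  proof -
    have "0 < 1 / (16 * sqrt 2) * \<kappa> * lam"
      using small e unfolding lam_def e_def E_def by linarith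
    then have lam: "0 < lam" using \<kappa> by (simp add: zero_less_divide_iff zero_less_mult_iff)
    \<comment> \<open>A rational upper bound for the constant suffices, and 16 * 1.4 is slightly more than 22.\<close>
    have sq2: "1 / (16 * sqrt 2) \<le> 1 / (16 * 1.4 :: real)"
      by (intro divide_left_mono mult_left_mono real_le_rsqrt) (auto simp: power2_eq_square)
    have small': "e \<le> \<kappa> * lam / 22"
    proof -
      have "e \<le> 1 / (16 * sqrt 2) * (\<kappa> * lam)" using small by (simp add: e_def E_def lam_def)
      also have "\<dots> \<le> 1 / (16 * 1.4) * (\<kappa> * lam)" using sq2 \<kappa> lam by (intro mult_right_mono) auto
      also have "\<dots> \<le> \<kappa> * lam / 22" using \<kappa> lam by (simp add: mult_pos_pos)
      finally show ?thesis .
    qed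
    have "norm E \<le> lam / 4"
    proof -
      have "\<kappa> * lam \<le> 1 * lam" using \<kappa> lam by (intro mult_right_mono) auto
      then show ?thesis using small' lam unfolding e_def by linarith
    qed
    then obtain V R where VR: "E = ?J (2 *\<^sub>R (mat_of V ** X)) + R"
      "norm V \<le> sqrt (real CARD('r) - real r' + 1) / 4"
      "norm R \<le> 4 / lam * (norm E)\<^sup>2" "rank (mat_of R) \<le> r'"
      using gram_residual_decomposition[OF psd, of X] lam unfolding E_def lam_def r'_def by blast
    define y where "y = 2 *\<^sub>R (mat_of V ** X)"
    define m where "m = 2 * norm R + l * norm V"
    have R: "norm R \<le> \<kappa> * e * (4 / 22)"
    proof -
      have "norm R \<le> 4 / lam * (e * e)" using VR(3) by (simp add: e_def power2_eq_square)
      also have "\<dots> \<le> 4 / lam * (e * (\<kappa> * lam / 22))"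
        using small' e lam by (intro mult_left_mono) auto
      also have "\<dots> = \<kappa> * e * (4 / 22)" using lam by simp
      finally show ?thesis .
    qed
    have V: "l * norm V \<le> \<kappa> * e * (1 / 256)"
    proof -
      define N where "N = real CARD('r) - real r' + 1"
      have N: "1 \<le> N" using r' by (simp add: N_def)
      have "l * norm V \<le> (1 / (64 * sqrt (2 * N)) * \<kappa>\<^sup>2 * e) * (sqrt N / 4)"
      proof (intro mult_mono)
        have "l \<le> D * e" using l by (simp add: e_def E_def)
        also have "\<dots> \<le> 1 / (64 * sqrt (2 * N)) * \<kappa>\<^sup>2 * e"
          using D e unfolding N_def by (intro mult_right_mono) auto
        finally show "l \<le> 1 / (64 * sqrt (2 * N)) * \<kappa>\<^sup>2 * e" .
      qed (use VR(2) e N in \<open>auto simp: N_def\<close>)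
      also have "\<dots> = \<kappa>\<^sup>2 * e / (256 * sqrt 2)"
        using N by (simp add: real_sqrt_mult)
      also have "\<dots> \<le> \<kappa>\<^sup>2 * e / 256" using e by (intro divide_left_mono) auto
      also have "\<kappa>\<^sup>2 * e \<le> \<kappa> * e" using \<kappa> e by (simp add: power2_eq_square)
      finally show ?thesis by simp
    qed
    have m: "0 \<le> m" "m \<le> \<kappa> * e * (2 / 5)"
    proof -
      have "0 \<le> \<kappa> * e" using \<kappa> e by simp
      then show "m \<le> \<kappa> * e * (2 / 5)" using R V unfolding m_def by linarith
      show "0 \<le> m" using l0 by (simp add: m_def)
    qed
    have "?J y \<bullet> ?J u = v \<bullet> ?J y - l * (V \<bullet> ?J u)"
      by (rule bounds(3)) (simp add: y_def inner_gram_deriv)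
    moreover have "v \<bullet> ?J y = 2 * s\<^sup>2 - v \<bullet> R"
    proof -
      have "v \<bullet> ?J y = v \<bullet> (E - R)" using VR(1) by (simp add: y_def)
      then show ?thesis by (simp add: inner_diff_right v[of E] s_def power2_norm_eq_inner)
    qed
    moreover have "E \<bullet> ?J u = ?J y \<bullet> ?J u + R \<bullet> ?J u"
      using VR(1) by (simp add: y_def flip: inner_add_left)
    ultimately have split: "E \<bullet> ?J u = 2 * s\<^sup>2 - v \<bullet> R - l * (V \<bullet> ?J u) + R \<bullet> ?J u" by simp
    define c where "c = 2 * sqrt (1 + \<delta>) * s"
    have vR: "v \<bullet> R \<le> c * norm R"
    proof -
      have "v \<bullet> R \<le> 2 * (s * norm (\<A> R))"
        unfolding v s_def using norm_cauchy_schwarz[of "\<A> E" "\<A> R"] by simp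
      also have "norm (\<A> R) \<le> sqrt (1 + \<delta>) * norm R" using VR(4) r' by (intro ripD(2)) simp
      finally show ?thesis using s0 by (simp add: c_def mult_ac)
    qed
    have w: "\<bar>Y \<bullet> ?J u\<bar> \<le> c * norm Y" for Y
    proof -
      have "\<bar>Y \<bullet> ?J u\<bar> \<le> norm Y * norm (?J u)" by (rule Cauchy_Schwarz_ineq2)
      also have "\<dots> \<le> norm Y * c"
        using bounds(1) q_le unfolding c_def by (intro mult_left_mono) auto
      finally show ?thesis by (simp add: mult.commute)
    qed
    have "l * (V \<bullet> ?J u) \<le> l * (c * norm V)" using w[of V] l0 by (intro mult_left_mono) auto
    moreover have "- (R \<bullet> ?J u) \<le> c * norm R" using w[of R] by linarith
    moreover have "c * m = 2 * (c * norm R) + l * (c * norm V)" by (simp add: m_def algebra_simps)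
    ultimately have "2 * s\<^sup>2 - c * m \<le> E \<bullet> ?J u" using split vR by linarith
    moreover have "c * m \<le> s\<^sup>2"
      unfolding c_def by (rule isometry_absorbs_error[OF \<delta> s_e _ _ m[unfolded \<kappa>_def]]) (use s0 e in auto)
    ultimately show ?thesis by (simp add: hs)
  qed

  have U: "norm (gram u) \<le> (norm q)\<^sup>2 / (4 * l)"
  proof -
    have "(norm u)\<^sup>2 \<le> (norm q)\<^sup>2 / (4 * l)" using bounds(2) l0 by (simp add: field_simps)
    then show ?thesis using norm_gram_le[of u] by linarith
  qed
  have expand: "gram (X - g *\<^sub>R u) - Zs = E - g *\<^sub>R ?J u + g\<^sup>2 *\<^sub>R gram u"
    using gram_add[of X "- (g *\<^sub>R u)"] gram_scaleR[of "- g" u] linear_gram_deriv[of X]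
    by (simp add: E_def linear_neg linear_scale)
  have descent: "(norm (E - g *\<^sub>R ?J u + g\<^sup>2 *\<^sub>R gram u))\<^sup>2 \<le> e\<^sup>2 - g * h (gram X) / 2"
    unfolding e_def
    by (rule polyak_step_descent[OF bounds(1) aligned _ U l(1) _ \<gamma> g]) (use s0 l in \<open>auto simp: hs E_def\<close>)
  have rate: "\<gamma> / 32 * \<kappa> * e\<^sup>2 \<le> g * h (gram X) / 2"
  proof -
    have "0 < norm q"
    proof -
      have "0 < E \<bullet> ?J u" using aligned zero_less_power[OF s0, of 2] unfolding hs by linarith
      then have "?J u \<noteq> 0" by auto
      then show ?thesis using bounds(1) by (meson less_le_trans zero_less_norm_iff)
    qed
    have q2: "(norm q)\<^sup>2 \<le> 4 * (1 + \<delta>) * s\<^sup>2"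
      using power_mono[OF q_le, of 2] \<delta> by (simp add: power_mult_distrib)
    have "\<kappa> * (1 + \<delta>) * e\<^sup>2 \<le> s\<^sup>2"
      using ratio_bounds(3)[OF \<delta>, folded \<kappa>_def] s_e
      by (rule order_trans[OF mult_right_mono[OF _ zero_le_power2]])
    then have "4 * s\<^sup>2 * (\<kappa> * (1 + \<delta>) * e\<^sup>2) \<le> 4 * s\<^sup>2 * s\<^sup>2" by (intro mult_left_mono) auto
    moreover have "\<kappa> * e\<^sup>2 * (norm q)\<^sup>2 \<le> \<kappa> * e\<^sup>2 * (4 * (1 + \<delta>) * s\<^sup>2)"
      using q2 \<kappa> by (intro mult_left_mono) auto
    moreover have "\<kappa> * e\<^sup>2 * (4 * (1 + \<delta>) * s\<^sup>2) = 4 * s\<^sup>2 * (\<kappa> * (1 + \<delta>) * e\<^sup>2)"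
      by (simp only: mult_ac)
    ultimately have "\<kappa> * e\<^sup>2 * (norm q)\<^sup>2 \<le> 4 * s\<^sup>2 * s\<^sup>2" by linarith
    then have "\<kappa> * e\<^sup>2 \<le> 4 * (s\<^sup>2 * s\<^sup>2 / (norm q)\<^sup>2)"
      using \<open>0 < norm q\<close> by (simp add: pos_le_divide_eq mult_ac)
    then have "\<gamma> * (\<kappa> * e\<^sup>2) \<le> \<gamma> * (4 * (s\<^sup>2 * s\<^sup>2 / (norm q)\<^sup>2))"
      using \<gamma> by (intro mult_left_mono) auto
    also have "\<dots> = 4 * (g * h (gram X))" by (simp add: g hs)
    finally have "\<gamma> * (\<kappa> * e\<^sup>2) \<le> 4 * (g * h (gram X))" .
    moreover have "0 \<le> g * h (gram X)" using \<gamma> by (simp add: g hs)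
    moreover have "\<gamma> / 32 * \<kappa> * e\<^sup>2 = \<gamma> * (\<kappa> * e\<^sup>2) / 32" by simp
    ultimately show ?thesis by linarith
  qed
  have "(norm (gram (lmm_step gram h g l X) - Zs))\<^sup>2 \<le> e\<^sup>2 - \<gamma> / 32 * \<kappa> * e\<^sup>2"
    using descent rate unfolding step expand by linarith
  then show ?thesis by (simp add: e_def E_def left_diff_distrib)
qed

theorem corollary5p9:
  fixes \<A> :: "'d::finite sym_mat \<Rightarrow> real^'m"
    and b :: "real^'m"
    and Zstar :: "'d sym_mat"
    and rstar :: nat
    and X :: "nat \<Rightarrow> real^'r^'d"
    and \<delta> \<gamma> C_lb C_ub :: real
    and steps damps :: "nat \<Rightarrow> real"
  assumes "psd Zstar"
    and "rank (mat_of Zstar) = rstar"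
    and "1 \<le> rstar" "rstar \<le> CARD('r)"
    and "linear \<A>"
    and "0 < \<delta>" "\<delta> < 1"
    and "\<And>Z. rank (mat_of Z) \<le> 6 * CARD('r) \<Longrightarrow>
           (1 - \<delta>) * (norm Z)\<^sup>2 \<le> (norm (\<A> Z))\<^sup>2 \<and> (norm (\<A> Z))\<^sup>2 \<le> (1 + \<delta>) * (norm Z)\<^sup>2"
    and "b = \<A> Zstar"
    and "0 < \<gamma>" "0 < C_lb" "C_lb \<le> C_ub"
    and "lmm_iterates gram (sensing_loss \<A> b) steps damps X"
    and "polyak_configuration gram (sensing_loss \<A> b) \<gamma> C_lb C_ub steps damps X"
    and "\<gamma> \<le> min 1 (C_lb / 2)"
    and "C_ub \<le> 1 / (64 * sqrt (2 * (real CARD('r) - real rstar + 1))) * ((1 - \<delta>)^4 / (1 + \<delta>)^4)"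
    and "norm (gram (X 0) - Zstar) \<le> 1 / (16 * sqrt 2) * ((1 - \<delta>)\<^sup>2 / (1 + \<delta>)\<^sup>2) * eigval rstar Zstar"
  shows "\<forall>k. (norm (gram (X k) - Zstar))\<^sup>2
           \<le> (1 - \<gamma> / 32 * ((1 - \<delta>)\<^sup>2 / (1 + \<delta>)\<^sup>2)) ^ k * (norm (gram (X 0) - Zstar))\<^sup>2"
proof -
  define \<kappa> where "\<kappa> = (1 - \<delta>)\<^sup>2 / (1 + \<delta>)\<^sup>2"
  define \<rho> where "\<rho> = 1 - \<gamma> / 32 * \<kappa>"
  define \<epsilon> where "\<epsilon> k = (norm (gram (X k) - Zstar))\<^sup>2" for k
  let ?h = "sensing_loss \<A> (\<A> Zstar)"
  have rip: "restricted_isometry (6 * CARD('r)) \<delta> \<A>"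
    using assms(8) by (simp add: restricted_isometry_def)
  note rank = assms(4)[folded assms(2)]
  note min = sensing_minimizers[OF assms(5) rip assms(7,1) rank]
  have \<kappa>: "0 \<le> \<kappa>" "\<kappa> \<le> 1"
    using ratio_bounds(1,2)[OF assms(6,7)] by (simp_all add: \<kappa>_def)
  have \<gamma>: "0 < \<gamma>" "\<gamma> \<le> 1" "\<gamma> \<le> C_lb / 2" using assms(10,15) by auto
  have \<rho>: "0 \<le> \<rho>" "\<rho> \<le> 1"
    using \<kappa> \<gamma> mult_mono[of \<gamma> 1 \<kappa> 1] by (auto simp: \<rho>_def)
  have D: "C_ub \<le> 1 / (64 * sqrt (2 * (real CARD('r) - real (rank (mat_of Zstar)) + 1))) * \<kappa>\<^sup>2"
    using assms(2,16) by (simp add: \<kappa>_def power_divide flip: power_mult)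
  \<comment> \<open>The hypothesis on the initial point is inherited as long as the residual has not grown.\<close>
  have step: "\<epsilon> (Suc k) \<le> \<rho> * \<epsilon> k" if near: "\<epsilon> k \<le> \<epsilon> 0" for k
  proof (cases "gram (X k) = Zstar")
    case True
    then have "X (Suc k) = X k"
      using assms(13) min(1) unfolding lmm_iterates_def assms(9) by auto
    then show ?thesis using True by (simp add: \<epsilon>_def)
  next
    case False
    then have nmin: "gram (X k) \<notin> minimizers ?h (range (gram :: real^'r^'d \<Rightarrow> _))" by (simp add: min(1))
    then have upd: "X (Suc k) = lmm_step gram ?h (steps k) (damps k) (X k)"
      using assms(13) unfolding lmm_iterates_def assms(9) by auto
    have conf: "steps k = \<gamma> * ?h (gram (X k)) / (norm (orth_proj (range (gram_deriv (X k))) (gradient ?h (gram (X k)))))\<^sup>2"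
      "C_lb * norm (gram (X k) - Zstar) \<le> damps k" "damps k \<le> C_ub * norm (gram (X k) - Zstar)"
      using assms(14) nmin unfolding polyak_configuration_def assms(9) Let_def
      by (auto simp: min frechet_derivative_gram dist_norm)
    have "norm (gram (X k) - Zstar) \<le> norm (gram (X 0) - Zstar)"
      using near by (simp add: \<epsilon>_def)
    then have "norm (gram (X k) - Zstar) \<le> 1 / (16 * sqrt 2) * \<kappa> * eigval (rank (mat_of Zstar)) Zstar"
      using assms(17) assms(2) by (simp add: \<kappa>_def)
    from lmm_step_contraction[OF assms(5) rip assms(6,7,1) rank False this[unfolded \<kappa>_def] \<gamma> conf(1) assms(11) conf(2,3) D[unfolded \<kappa>_def]]
    show ?thesis by (simp add: \<epsilon>_def \<rho>_def \<kappa>_def upd)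
  qed
  have "\<epsilon> k \<le> \<rho> ^ k * \<epsilon> 0" for k
  proof (induction k)
    case (Suc k)
    have "\<rho> ^ k * \<epsilon> 0 \<le> 1 * \<epsilon> 0"
      using \<rho> by (intro mult_right_mono power_le_one) (auto simp: \<epsilon>_def)
    then have "\<epsilon> (Suc k) \<le> \<rho> * \<epsilon> k" using Suc by (intro step) simp
    also have "\<dots> \<le> \<rho> * (\<rho> ^ k * \<epsilon> 0)" using Suc \<rho> by (intro mult_left_mono)
    finally show ?case by simp
  qed simp
  then show ?thesis by (simp add: \<epsilon>_def \<rho>_def \<kappa>_def)
qed

end
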